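(* Assume that an approximate expectation operator $\hat{\mathbb E}[\hat V_{t,x}(\phi,\phi')]$ as described in the context exists, with $\mathcal E(\hat{\mathbb E})<\infty$. Then, for the exact iterates $v^m$ and the numerical iterates $\hat v^m$, $m\ge1$, $$\big\|\mathbb E[|v^m-\hat v^m|]\big\|_\infty\le\mathcal E(\hat{\mathbb E})\,(1+N_h)\,\frac{(m+N_h)^{N_h}}{N_h!}\Big((2L_\varphi M^2_h)\vee\frac{M^1_h}{M}\vee1\Big)^{m+N_h}.$$
   Context: Setting. $T>0$; $W$ is a standard $d$-dimensional Brownian motion on a filtered probability space; $\mathbf X\subset\mathbb R^d$ is compact, $X_0\in\mathbf X$ is constant; $\mu:\mathbb R^d\to\mathbb R^d$ and $\sigma:\mathbb R^d\to\mathbb R^{d\times d}$ are Lipschitz with support contained in $\mathbf X$; $X=X_0+\int_0^\cdot\mu(X_s)ds+\int_0^\cdot\sigma(X_s)dW_s$; $g:\mathbb R^d\to\mathbb R$ is measurable and bounded; $f:\mathbb R^d\times\mathbb R\to\mathbb R$ is measurable, with linear growth, Lipschitz in its second argument uniformly in the first; $(Y,Z)$ solves $Y_\cdot=g(X_T)+\int_\cdot^T f(X_s,Y_s)ds-\int_\cdot^T Z_sdW_s$. Driver. $\ell_\circ\ge2$, $j_\circ\ge1$ are integers and $f_{\ell_\circ}(x,y,y')=\sum_{j=1}^{j_\circ}\sum_{\ell=0}^{\ell_\circ}a_{j,\ell}(x)y^\ell\varphi_j(y')$, where $a_{j,\ell}:\mathbb R^d\to\mathbb R$ and $\varphi_j:\mathbb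 R\to\mathbb R$ are continuous and bounded, $|a_{j,\ell}|\le C_{\ell_\circ}$, $\varphi_j$ is $L_\varphi$-Lipschitz, $|\varphi_j|\le1$ (for constants $C_{\ell_\circ},L_\varphi\ge0$), $\#\{j:\varphi_j(y)>0\}\le2$ for all $y\in\mathbb R$, and $y\mapsto f_{\ell_\circ}(x,y,y)$ is globally Lipschitz. $(\bar Y,\bar Z)$ is the unique solution of $\bar Y_\cdot=g(X_T)+\int_\cdot^T f_{\ell_\circ}(X_s,\bar Y_s,\bar Y_s)ds-\int_\cdot^T\bar Z_sdW_s$ with $\mathbb E[\sup_{[0,T]}|\bar Y|^2]<\infty$. $M\ge1$ is a constant with $|g(X_T)|\le M$, and $|X|+|Y|\le M$ and $|\bar Y|\le M$ on $[0,T]$. $\mathrm y$ is a deterministic function on $[0,T]\times\mathbb R^d$, bounded by $M$, with $\mathrm y(T,\cdot)=g$. Constants and grid. Set $$h_\circ:=\frac{(\ell_\circ-1)(1-M)^++(1\vee M)^{-(\ell_\circ-1)}}{(\ell_\circ+1)(\ell_\circ-1)2C_{\ell_\circ}},$$ $$M_{h_\circ}:=\max\Big(1,\ \big((1\vee M)^{1-\ell_\circ}+(\ell_\circ-1)(1-M)^+-h_\circ\ell_\circ(\ell_\circ-1)2C_{\ell_\circ}\big)^{(1-\ell_\circ)^{-1}}\Big).$$ Fix $h\in(0,h_\circ)$ with $N_h:=T/h\in\mathbb N$; $t_i:=ih$, $0\le i\le N_h$. Branching particles. $(p_\ell)_{0\le\ell\le\ell_\circ}$ are nonnegative with $\sum_\ell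 p_\ell=1$. $K_n:=\{(1,k_2,\dots,k_n):k_2,\dots,k_n\in\{0,\dots,\ell_\circ\}\}$, $K:=\bigcup_{n\ge1}K_n$; for $k=(1,k_2,\dots,k_{n-1})\in K_{n-1}$, $k\oplus j:=(1,k_2,\dots,k_{n-1},j)$; for $k=(1,k_2,\dots,k_n)\in K_n$ with $n\ge2$, $k-:=(1,k_2,\dots,k_{n-1})$. $(W^k)_{k\in K}$ are independent $d$-dimensional Brownian motions; $(\xi_k)_{k\in K}$ are independent with $\mathbb P[\xi_k=\ell]=p_\ell$, $\ell\le\ell_\circ$; $(\delta_k)_{k\in K}$ are independent with $\bar F(t):=\mathbb P[\delta_k>t]=\int_t^\infty\rho(s)ds$, $t\ge0$, where $\rho:\mathbb R_+\to\mathbb R_+$ is continuous and strictly positive. These three families and $W$ are independent. Set $T_{(1)-}:=0$, $T_{(1)}:=\delta_{(1)}$, and $T_k:=\delta_k+T_{k-}$ for $k\in K_n$, $n\ge2$. Set $W^{((1))}:=W^{1}\mathbf 1_{[0,T_{(1)}]}$ (where $W^1$ is the Brownian motion of the family indexed by $(1)\in K_1$) and, for $k\in K_{n-1}$, $n\ge2$, $0\le j\le\xi_k$, $W^{(k\oplus j)}:=\big(W^{(k)}_{\cdot\wedge T_k}+(W^{k\oplus j}_{\cdot\vee T_k}-W^{k\oplus j}_{T_k})\mathbf 1_{j\ne0}\big)\mathbf 1_{[0,T_{k\oplus j}]}$. $\bar{\mathcal K}^1_t:=\{(1)\}$; $\mathcal K^1_t:=\{(1)\}$ if $t<T_{(1)}$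 and $\emptyset$ otherwise; for $n\ge2$, $\bar{\mathcal K}^n_t:=\{k\oplus j:k\in\bar{\mathcal K}^{n-1}_T,1\le j\le\xi_k,\ t\ge T_k\}$, $\mathcal K^n_t:=\{k\oplus j:k\in\bar{\mathcal K}^{n-1}_T,1\le j\le\xi_k,\ t\in[T_k,T_{k\oplus j})\}$; $\bar{\mathcal K}_t:=\bigcup_{n\ge1}\bar{\mathcal K}^n_t$, $\mathcal K_t:=\bigcup_{n\ge1}\mathcal K^n_t$. Writing the solution of the SDE for $X$ started at $x$ as $\Phi[x](\cdot,W)$, where $(x,s,\omega)\mapsto\Phi[x](s,\omega)$ is deterministic and $\mathcal B(\mathbb R^d)\otimes\mathcal P$-measurable ($\mathcal P$ the predictable $\sigma$-field on the canonical space), set $X^{x,(k)}:=\Phi[x](\cdot,W^{(k)})$. Set $q_t:=\#\mathcal K_t$, $\bar q_t:=\#\bar{\mathcal K}_t$, $$V^M_t:=\Big(\prod_{k\in\mathcal K_t}\frac{M}{\bar F(t-T_{k-})}\Big)\Big(\prod_{k\in\bar{\mathcal K}_t\setminus\mathcal K_t}\frac{2C_{\ell_\circ}}{p_{\xi_k}\rho(\delta_k)}\Big),\qquad M^1_h:=\sup_{0\le t\le h}\mathbb E[q_tV^M_t],\quad M^2_h:=\sup_{0\le t\le h}\mathbb E[\bar q_tV^M_t]$$ (the superscripts $1,2$ are indices, not powers). Operator $V$. For functions $\phi,\phi':(t_i,t_{i+1}]\times\mathbb R^d\to\mathbb R$ and $t\in[t_i,t_{i+1})$, $$V_{t,x}(\phi,\phi'):=\Big(\prod_{k\in\mathcal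 K_{t_{i+1}-t}}\frac{\phi(t_{i+1},X^{x,(k)}_{t_{i+1}-t})}{\bar F(t_{i+1}-t-T_{k-})}\Big)\Big(\prod_{k\in\bar{\mathcal K}_{t_{i+1}-t}\setminus\mathcal K_{t_{i+1}-t}}\frac{\sum_{j=1}^{j_\circ}a_{j,\xi_k}(X^{x,(k)}_{T_k})\varphi_j(\phi'(t+T_k,X^{x,(k)}_{T_k}))}{p_{\xi_k}\rho(\delta_k)}\Big).$$ Only the values $\phi(t_{i+1},\cdot)$ of the first argument matter. Exact iterates. $v^0:=\mathrm y$; for $m\ge1$, $v^m(T,\cdot):=g$ and, backward in $i$, $v^m(t,x):=\mathbb E[V_{t,x}(v^m(t_{i+1},\cdot),v^{m-1})]$ for $t\in(t_i,t_{i+1})$ and $v^m(t_i,x):=(-M)\vee\mathbb E[V_{t_i,x}(v^m(t_{i+1},\cdot),v^{m-1})]\wedge M$. Norm. $\|\psi\|_\infty:=\sup_{(t,x)\in[0,T]\times\mathbb R^d}|\psi(t,x)|$. Approximate operator (the assumption). $\mathbf L^\infty_{M_{h_\circ}}$ is the class of Borel measurable functions $[0,T]\times\mathbb R^d\to\mathbb R$ bounded by $M_{h_\circ}$, and $\mathbf L^\infty_{M_{h_\circ},0}\subset\mathbf L^\infty_{M_{h_\circ}}$ is a subspace generated by a finite number of basis functions. $(U_i)_{i\ge1}$ are i.i.d. uniform on $[0,1]$, independent of $(W^k)_{k\in K},(\xi_k)_{k\in K},(\delta_k)_{k\in K}$ and $W$; $\hat{\mathcal F}:=\sigma(U_i,i\ge1)$.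 There exists an operator $\hat{\mathbb E}[\hat V_{t,x}(\phi,\phi')](\omega)$, defined for all $\phi,\phi'\in\mathbf L^\infty_{M_{h_\circ},0}$, such that $(t,x,\omega)\mapsto\hat{\mathbb E}[\hat V_{t,x}(\phi,\phi')](\omega)$ is $\mathcal B([0,T]\times\mathbb R^d)\otimes\hat{\mathcal F}$-measurable, and such that $(t,x)\mapsto\hat{\mathbb E}[\hat V_{t,x}(\phi,\phi')](\omega)$ belongs to $\mathbf L^\infty_{M_{h_\circ},0}$ for every fixed $\omega\in\Omega$. Moreover, $$\mathcal E(\hat{\mathbb E}):=\Big\|\sup_{\phi,\phi'\in\mathbf L^\infty_{M_{h_\circ},0}}\mathbb E\big[\big|\mathbb E[V_\cdot(\phi,\phi')]-\hat{\mathbb E}[\hat V_\cdot(\phi,\phi')]\big|\big]\Big\|_\infty<\infty.$$ Numerical scheme. $\hat v^0:=\mathrm y$; for $m\ge1$, $\hat v^m(T,\cdot):=g$ and, by induction over $m$ and backward in $i$, $\hat v^m(t,x):=(-M_{h_\circ})\vee\hat{\mathbb E}[\hat V_{t,x}(\hat v^m(t_{i+1},\cdot),\hat v^{m-1})]\wedge M_{h_\circ}$ for $t\in(t_i,t_{i+1})$ and $\hat v^m(t_i,x):=(-M)\vee\hat{\mathbb E}[\hat V_{t_i,x}(\hat v^m(t_{i+1},\cdot),\hat v^{m-1})]\wedge M$. In the claim, $\mathbb E[|v^m-\hat v^m|]$ denotes the function $(t,x)\mapsto\mathbb E[|v^m(t,x)-\hat v^m(t,x)|]$.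
   Formalization: The error E(Ê) and the measurability of Ê are taken over random F̂-measurable φ,φ', not only deterministic ones, and at most two φ_j(y) are non-zero, not just positive; the claim fails otherwise. The scheme's arguments are assumed to lie in the domain of Ê. *)

theory Defs
  imports "HOL-Probability.Probability"
begin

section \<open>Stochastic analysis\<close>

definition generated :: "'w set \<Rightarrow> 'i set \<Rightarrow> ('i \<Rightarrow> 'w \<Rightarrow> 'b::topological_space) \<Rightarrow> 'w measure" where
  "generated \<Omega> I X = sigma \<Omega> {X i -` A \<inter> \<Omega> | i A. i \<in> I \<and> A \<in> sets borel}"

definition filtered_space :: "'w measure \<Rightarrow> (real \<Rightarrow> 'w measure) \<Rightarrow> bool" where
  "filtered_space M F \<longleftrightarrow> prob_space M \<and> filtration (space M) F \<and> (\<forall>t. subalgebra M (F t))"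

definition brownian_motion ::
  "'w measure \<Rightarrow> (real \<Rightarrow> 'w measure) \<Rightarrow> (real \<Rightarrow> 'w \<Rightarrow> real^'d) \<Rightarrow> bool" where
  "brownian_motion M F W \<longleftrightarrow>
     (\<forall>\<omega>\<in>space M. W 0 \<omega> = 0 \<and> continuous_on {0..} (\<lambda>t. W t \<omega>)) \<and>
     (\<forall>t\<ge>0. W t \<in> borel_measurable (F t)) \<and>
     (\<forall>s\<ge>0. \<forall>t>s.
        prob_space.indep_set M (sets (F s)) (sets (vimage_algebra (space M) (\<lambda>\<omega>. W t \<omega> - W s \<omega>) borel)) \<and>
        prob_space.indep_vars M (\<lambda>_. borel) (\<lambda>i \<omega>. (W t \<omega> - W s \<omega>) $ i) UNIV \<and>
        (\<forall>i. distributed M lborel (\<lambda>\<omega>. (W t \<omega> - W s \<omega>) $ i) (normal_density 0 (sqrt (t - s)))))"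

definition progressive ::
  "(real \<Rightarrow> 'w measure) \<Rightarrow> real \<Rightarrow> (real \<Rightarrow> 'w \<Rightarrow> 'b::topological_space) \<Rightarrow> bool" where
  "progressive F T H \<longleftrightarrow>
     (\<forall>t\<in>{0..T}. (\<lambda>(s, \<omega>). H s \<omega>) \<in> borel_measurable (restrict_space borel {0..t} \<Otimes>\<^sub>M F t))"

text \<open>
  The simple process with nodes \<open>s\<close> and values \<open>\<eta>\<close> equals \<open>\<eta> j\<close> on \<open>(s j, s (j+1)]\<close>.
\<close>

definition simple_process ::
  "'w measure \<Rightarrow> (real \<Rightarrow> 'w measure) \<Rightarrow> real \<Rightarrow> nat \<Rightarrow> (nat \<Rightarrow> real) \<Rightarrow> (nat \<Rightarrow> 'w \<Rightarrow> real^'d) \<Rightarrow> bool" where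
  "simple_process M F T n s \<eta> \<longleftrightarrow>
     0 \<le> s 0 \<and> (\<forall>j<n. s j \<le> s (Suc j)) \<and> s n \<le> T \<and>
     (\<forall>j<n. \<eta> j \<in> borel_measurable (F (s j)) \<and> bounded (\<eta> j ` space M))"

definition simple_value ::
  "nat \<Rightarrow> (nat \<Rightarrow> real) \<Rightarrow> (nat \<Rightarrow> 'w \<Rightarrow> real^'d) \<Rightarrow> real \<Rightarrow> 'w \<Rightarrow> real^'d" where
  "simple_value n s \<eta> t \<omega> = (\<Sum>j<n. indicator {s j<..s (Suc j)} t *\<^sub>R \<eta> j \<omega>)"

definition simple_integral ::
  "nat \<Rightarrow> (nat \<Rightarrow> real) \<Rightarrow> (nat \<Rightarrow> 'w \<Rightarrow> real^'d) \<Rightarrow> (real \<Rightarrow> 'w \<Rightarrow> real^'d) \<Rightarrow> real \<Rightarrow> 'w \<Rightarrow> real" where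
  "simple_integral n s \<eta> W t \<omega> = (\<Sum>j<n. \<eta> j \<omega> \<bullet> (W (min t (s (Suc j))) \<omega> - W (min t (s j)) \<omega>))"

text \<open>
  \<open>ito_integral M F T W H I\<close>: the continuous process \<open>I\<close> is the Ito integral of the row vector
  process \<open>H\<close> against \<open>W\<close> on \<open>[0,T]\<close>, that is, the limit, uniformly on \<open>[0,T]\<close> in probability,
  of the integrals of simple processes which approximate \<open>H\<close> in \<open>L\<^sup>2([0,T])\<close> in probability.
\<close>

definition ito_integral ::
  "'w measure \<Rightarrow> (real \<Rightarrow> 'w measure) \<Rightarrow> real \<Rightarrow> (real \<Rightarrow> 'w \<Rightarrow> real^'d) \<Rightarrow>
   (real \<Rightarrow> 'w \<Rightarrow> real^'d) \<Rightarrow> (real \<Rightarrow> 'w \<Rightarrow> real) \<Rightarrow> bool" where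
  "ito_integral M F T W H I \<longleftrightarrow>
     progressive F T H \<and>
     (AE \<omega> in M. (\<integral>\<^sup>+t\<in>{0..T}. ennreal ((norm (H t \<omega>))\<^sup>2) \<partial>lborel) < \<infinity>) \<and>
     (\<forall>t\<in>{0..T}. I t \<in> borel_measurable M) \<and>
     (\<forall>\<omega>\<in>space M. continuous_on {0..T} (\<lambda>t. I t \<omega>)) \<and>
     (\<exists>n s \<eta>. (\<forall>m. simple_process M F T (n m) (s m) (\<eta> m)) \<and>
        (\<forall>\<epsilon>>0. (\<lambda>m. measure M {\<omega> \<in> space M.
            ennreal \<epsilon> < (\<integral>\<^sup>+t\<in>{0..T}. ennreal ((norm (simple_value (n m) (s m) (\<eta> m) t \<omega> - H t \<omega>))\<^sup>2) \<partial>lborel)})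
          \<longlonglongrightarrow> 0) \<and>
        (\<forall>\<epsilon>>0. (\<lambda>m. measure M {\<omega> \<in> space M.
            \<exists>t\<in>{0..T}. \<epsilon> < \<bar>simple_integral (n m) (s m) (\<eta> m) W t \<omega> - I t \<omega>\<bar>})
          \<longlonglongrightarrow> 0))"

definition sde_solution ::
  "'w measure \<Rightarrow> (real \<Rightarrow> 'w measure) \<Rightarrow> real \<Rightarrow> (real \<Rightarrow> 'w \<Rightarrow> real^'d) \<Rightarrow>
   (real^'d \<Rightarrow> real^'d) \<Rightarrow> (real^'d \<Rightarrow> real^'d^'d) \<Rightarrow> real^'d \<Rightarrow> (real \<Rightarrow> 'w \<Rightarrow> real^'d) \<Rightarrow> bool" where
  "sde_solution M F T W \<mu> \<sigma> x X \<longleftrightarrow>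
     progressive F T X \<and> (AE \<omega> in M. continuous_on {0..T} (\<lambda>t. X t \<omega>)) \<and>
     (\<exists>I. (\<forall>i. ito_integral M F T W (\<lambda>s \<omega>. \<sigma> (X s \<omega>) $ i) (I i)) \<and>
        (AE \<omega> in M. \<forall>t\<in>{0..T}.
           X t \<omega> = x + (LBINT s:{0..t}. \<mu> (X s \<omega>)) + (\<chi> i. I i t \<omega>)))"

definition bsde_solution ::
  "'w measure \<Rightarrow> (real \<Rightarrow> 'w measure) \<Rightarrow> real \<Rightarrow> (real \<Rightarrow> 'w \<Rightarrow> real^'d) \<Rightarrow>
   ('w \<Rightarrow> real) \<Rightarrow> (real \<Rightarrow> 'w \<Rightarrow> real \<Rightarrow> real) \<Rightarrow> (real \<Rightarrow> 'w \<Rightarrow> real) \<Rightarrow> (real \<Rightarrow> 'w \<Rightarrow> real^'d) \<Rightarrow> bool" where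
  "bsde_solution M F T W \<zeta> drv Y Z \<longleftrightarrow>
     progressive F T Y \<and> (AE \<omega> in M. continuous_on {0..T} (\<lambda>t. Y t \<omega>)) \<and>
     (\<exists>I. ito_integral M F T W Z I \<and>
        (AE \<omega> in M. \<forall>t\<in>{0..T}.
           Y t \<omega> = \<zeta> \<omega> + (LBINT s:{t..T}. drv s \<omega> (Y s \<omega>)) - (I T \<omega> - I t \<omega>)))"

definition sup_square_integrable :: "'w measure \<Rightarrow> real \<Rightarrow> (real \<Rightarrow> 'w \<Rightarrow> real) \<Rightarrow> bool" where
  "sup_square_integrable M T Y \<longleftrightarrow> (\<integral>\<^sup>+\<omega>. (SUP t\<in>{0..T}. ennreal ((Y t \<omega>)\<^sup>2)) \<partial>M) < \<infinity>"

definition unique_bsde_solution ::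
  "'w measure \<Rightarrow> (real \<Rightarrow> 'w measure) \<Rightarrow> real \<Rightarrow> (real \<Rightarrow> 'w \<Rightarrow> real^'d) \<Rightarrow>
   ('w \<Rightarrow> real) \<Rightarrow> (real \<Rightarrow> 'w \<Rightarrow> real \<Rightarrow> real) \<Rightarrow> (real \<Rightarrow> 'w \<Rightarrow> real) \<Rightarrow> (real \<Rightarrow> 'w \<Rightarrow> real^'d) \<Rightarrow> bool" where
  "unique_bsde_solution M F T W \<zeta> drv Y Z \<longleftrightarrow>
     bsde_solution M F T W \<zeta> drv Y Z \<and> sup_square_integrable M T Y \<and>
     (\<forall>Y' Z'. bsde_solution M F T W \<zeta> drv Y' Z' \<and> sup_square_integrable M T Y' \<longrightarrow>
        (AE \<omega> in M. \<forall>t\<in>{0..T}. Y' t \<omega> = Y t \<omega>) \<and>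
        (AE \<omega> in M. AE t in lborel. t \<in> {0..T} \<longrightarrow> Z' t \<omega> = Z t \<omega>))"

text \<open>
  Canonical path space: all functions of time, with the filtration of the coordinate maps at
  times \<open>\<ge> 0\<close>. Discontinuous paths are admitted because the paths \<open>branch_path\<close> below jump to
  zero after the death of the particle; a predictable functional evaluated at time \<open>s\<close> sees the path
  only up to time \<open>s\<close>, so that these jumps are irrelevant.
\<close>

definition path_filtration :: "real \<Rightarrow> (real \<Rightarrow> real^'d) measure" where
  "path_filtration t = generated UNIV {0..t} (\<lambda>s w. w s)"

definition predictable :: "real \<Rightarrow> (real \<times> (real \<Rightarrow> real^'d)) measure" where
  "predictable T = sigma ({0..T} \<times> UNIV)
     ({{0} \<times> A | A. A \<in> sets (path_filtration 0)} \<union>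
      {{s<..t} \<times> A | s t A. 0 \<le> s \<and> s \<le> t \<and> t \<le> T \<and> A \<in> sets (path_filtration s)})"

section \<open>Constants\<close>

text \<open>
  With \<open>x / 0 = 0\<close>, \<open>h_circ l 0 M = 0\<close>. No step size \<open>0 < h < h_circ l C M\<close> exists then; the
  formula for \<open>M_circ\<close> would be undefined if \<open>h_circ l 0 M\<close> were read as infinite.
\<close>

definition h_circ :: "nat \<Rightarrow> real \<Rightarrow> real \<Rightarrow> real" where
  "h_circ l C M =
     ((real l - 1) * max (1 - M) 0 + (max 1 M) powr (- (real l - 1))) /
     ((real l + 1) * (real l - 1) * 2 * C)"

definition M_circ :: "nat \<Rightarrow> real \<Rightarrow> real \<Rightarrow> real" where
  "M_circ l C M =
     max 1 (((max 1 M) powr (1 - real l) + (real l - 1) * max (1 - M) 0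
              - h_circ l C M * real l * (real l - 1) * 2 * C) powr (1 / (1 - real l)))"

section \<open>Branching particles\<close>

text \<open>
  A label \<open>(1, k\<^sub>2, \<dots>, k\<^sub>n)\<close> is a list; \<open>k \<oplus> j\<close> is \<open>k @ [j]\<close> and \<open>k-\<close> is \<open>butlast k\<close>.
  The functions in this section take one realization \<open>W\<close>, \<open>\<xi>\<close>, \<open>\<delta>\<close> of the families.
\<close>

definition labels :: "nat \<Rightarrow> nat list set" where
  "labels l = {k. k \<noteq> [] \<and> hd k = 1 \<and> set (tl k) \<subseteq> {0..l}}"

text \<open>\<open>death \<delta> k\<close> is \<open>T\<^sub>k\<close>; the value 0 at the empty list yields the convention for \<open>T\<^bsub>(1)-\<^esub>\<close>.\<close>

function death :: "(nat list \<Rightarrow> real) \<Rightarrow> nat list \<Rightarrow> real" where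
  "death \<delta> k = (if k = [] then 0 else \<delta> k + death \<delta> (butlast k))"
  by auto
termination by (relation "Wellfounded.measure (\<lambda>(\<delta>, k). length k)") auto

declare death.simps [simp del]

function branch_path ::
  "(nat list \<Rightarrow> real \<Rightarrow> real^'d) \<Rightarrow> (nat list \<Rightarrow> real) \<Rightarrow> nat list \<Rightarrow> real \<Rightarrow> real^'d" where
  "branch_path W \<delta> k s =
     indicator {0..death \<delta> k} s *\<^sub>R
       (if length k \<le> 1 then W k s
        else (let r = death \<delta> (butlast k) in
          branch_path W \<delta> (butlast k) (min s r) +
          (if last k = 0 then 0 else W k (max s r) - W k r)))"
  by auto
termination by (relation "Wellfounded.measure (\<lambda>(W, \<delta>, k, s). length k)") auto

declare branch_path.simps [simp del]

text \<open>
  \<open>born_gen T \<xi> \<delta> n t\<close> and \<open>alive_gen T \<xi> \<delta> n t\<close> are the sets written with and without a bar;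
  generations are counted from \<open>n = 1\<close>.
\<close>

fun born_gen :: "real \<Rightarrow> (nat list \<Rightarrow> nat) \<Rightarrow> (nat list \<Rightarrow> real) \<Rightarrow> nat \<Rightarrow> real \<Rightarrow> nat list set" where
  "born_gen T \<xi> \<delta> 0 t = {}"
| "born_gen T \<xi> \<delta> (Suc 0) t = {[1]}"
| "born_gen T \<xi> \<delta> (Suc (Suc n)) t =
     {k @ [j] | k j. k \<in> born_gen T \<xi> \<delta> (Suc n) T \<and> 1 \<le> j \<and> j \<le> \<xi> k \<and> death \<delta> k \<le> t}"

fun alive_gen :: "real \<Rightarrow> (nat list \<Rightarrow> nat) \<Rightarrow> (nat list \<Rightarrow> real) \<Rightarrow> nat \<Rightarrow> real \<Rightarrow> nat list set" where
  "alive_gen T \<xi> \<delta> 0 t = {}"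
| "alive_gen T \<xi> \<delta> (Suc 0) t = (if t < death \<delta> [1] then {[1]} else {})"
| "alive_gen T \<xi> \<delta> (Suc (Suc n)) t =
     {k @ [j] | k j. k \<in> born_gen T \<xi> \<delta> (Suc n) T \<and> 1 \<le> j \<and> j \<le> \<xi> k \<and>
        death \<delta> k \<le> t \<and> t < death \<delta> (k @ [j])}"

definition born :: "real \<Rightarrow> (nat list \<Rightarrow> nat) \<Rightarrow> (nat list \<Rightarrow> real) \<Rightarrow> real \<Rightarrow> nat list set" where
  "born T \<xi> \<delta> t = (\<Union>n\<in>{1..}. born_gen T \<xi> \<delta> n t)"

definition alive :: "real \<Rightarrow> (nat list \<Rightarrow> nat) \<Rightarrow> (nat list \<Rightarrow> real) \<Rightarrow> real \<Rightarrow> nat list set" where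
  "alive T \<xi> \<delta> t = (\<Union>n\<in>{1..}. alive_gen T \<xi> \<delta> n t)"

definition tail_integral :: "(real \<Rightarrow> real) \<Rightarrow> real \<Rightarrow> real" where
  "tail_integral \<rho> t = (LBINT s:{t..}. \<rho> s)"

definition majorant ::
  "real \<Rightarrow> real \<Rightarrow> real \<Rightarrow> (nat \<Rightarrow> real) \<Rightarrow> (real \<Rightarrow> real) \<Rightarrow>
   (nat list \<Rightarrow> nat) \<Rightarrow> (nat list \<Rightarrow> real) \<Rightarrow> real \<Rightarrow> real" where
  "majorant T C M p \<rho> \<xi> \<delta> t =
     (\<Prod>k\<in>alive T \<xi> \<delta> t. M / tail_integral \<rho> (t - death \<delta> (butlast k))) *
     (\<Prod>k\<in>born T \<xi> \<delta> t - alive T \<xi> \<delta> t. 2 * C / (p (\<xi> k) * \<rho> (\<delta> k)))"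

text \<open>
  \<open>branch_op \<dots> t x u u'\<close> is \<open>V\<^bsub>t,x\<^esub>(u, u')\<close>, where \<open>r\<close> is the grid point \<open>t\<^bsub>i+1\<^esub>\<close> for
  \<open>t\<close> in \<open>[t\<^sub>i, t\<^bsub>i+1\<^esub>)\<close> and \<open>\<Phi> y s w\<close> is the SDE solution map.
\<close>

definition branch_op ::
  "real \<Rightarrow> real \<Rightarrow> nat \<Rightarrow> (nat \<Rightarrow> nat \<Rightarrow> real^'d \<Rightarrow> real) \<Rightarrow> (nat \<Rightarrow> real \<Rightarrow> real) \<Rightarrow>
   (nat \<Rightarrow> real) \<Rightarrow> (real \<Rightarrow> real) \<Rightarrow> (real^'d \<Rightarrow> real \<Rightarrow> (real \<Rightarrow> real^'d) \<Rightarrow> real^'d) \<Rightarrow>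
   (nat list \<Rightarrow> real \<Rightarrow> real^'d) \<Rightarrow> (nat list \<Rightarrow> nat) \<Rightarrow> (nat list \<Rightarrow> real) \<Rightarrow>
   real \<Rightarrow> real^'d \<Rightarrow> (real \<Rightarrow> real^'d \<Rightarrow> real) \<Rightarrow> (real \<Rightarrow> real^'d \<Rightarrow> real) \<Rightarrow> real" where
  "branch_op T h j0 a \<phi> p \<rho> \<Phi> W \<xi> \<delta> t x u u' =
     (let r = (of_int \<lfloor>t / h\<rfloor> + 1) * h;
          X = (\<lambda>k s. \<Phi> x s (branch_path W \<delta> k))
      in (\<Prod>k\<in>alive T \<xi> \<delta> (r - t).
            u r (X k (r - t)) / tail_integral \<rho> (r - t - death \<delta> (butlast k))) *
         (\<Prod>k\<in>born T \<xi> \<delta> (r - t) - alive T \<xi> \<delta> (r - t).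
            (\<Sum>j=1..j0. a j (\<xi> k) (X k (death \<delta> k)) *
               \<phi> j (u' (t + death \<delta> k) (X k (death \<delta> k)))) / (p (\<xi> k) * \<rho> (\<delta> k))))"

section \<open>Iterates\<close>

definition clamp_real :: "real \<Rightarrow> real \<Rightarrow> real" where
  "clamp_real c z = max (- c) (min z c)"

text \<open>
  A function on \<open>[0,T] \<times> \<real>\<^sup>d\<close> is represented by its extension by zero. The function \<open>u(s, \<cdot>)\<close> of
  the space variable is regarded as a function on \<open>[0,T] \<times> \<real>\<^sup>d\<close> which is constant in time.
\<close>

definition frozen :: "real \<Rightarrow> (real \<Rightarrow> real^'d \<Rightarrow> real) \<Rightarrow> real \<Rightarrow> real \<Rightarrow> real^'d \<Rightarrow> real" where
  "frozen T u s = (\<lambda>t x. if t \<in> {0..T} then u s x else 0)"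

definition exact_iterates ::
  "real \<Rightarrow> real \<Rightarrow> nat \<Rightarrow> real \<Rightarrow> (real^'d \<Rightarrow> real) \<Rightarrow> (real \<Rightarrow> real^'d \<Rightarrow> real) \<Rightarrow>
   (real \<Rightarrow> real^'d \<Rightarrow> (real \<Rightarrow> real^'d \<Rightarrow> real) \<Rightarrow> (real \<Rightarrow> real^'d \<Rightarrow> real) \<Rightarrow> real) \<Rightarrow>
   (nat \<Rightarrow> real \<Rightarrow> real^'d \<Rightarrow> real) \<Rightarrow> bool" where
  "exact_iterates T h N M g y EV v \<longleftrightarrow>
     v 0 = y \<and>
     (\<forall>m\<ge>1. (\<forall>x. v m T x = g x) \<and>
        (\<forall>i<N. \<forall>x.
           v m (real i * h) x =
             clamp_real M (EV (real i * h) x (frozen T (v m) (real (Suc i) * h)) (v (m - 1))) \<and>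
           (\<forall>t\<in>{real i * h <..< real (Suc i) * h}.
              v m t x = EV t x (frozen T (v m) (real (Suc i) * h)) (v (m - 1)))))"

definition Linf :: "real \<Rightarrow> real \<Rightarrow> (real \<Rightarrow> real^'d \<Rightarrow> real) set" where
  "Linf T B = {u. (\<lambda>(t, x). u t x) \<in> borel_measurable borel \<and>
     (\<forall>t\<in>{0..T}. \<forall>x. \<bar>u t x\<bar> \<le> B) \<and> (\<forall>t. t \<notin> {0..T} \<longrightarrow> (\<forall>x. u t x = 0))}"

text \<open>Those elements of \<open>Linf T B\<close> that are linear combinations of \<open>n\<close> basis functions.\<close>

definition Linf_span ::
  "real \<Rightarrow> real \<Rightarrow> nat \<Rightarrow> (nat \<Rightarrow> real \<Rightarrow> real^'d \<Rightarrow> real) \<Rightarrow> (real \<Rightarrow> real^'d \<Rightarrow> real) set" where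
  "Linf_span T B n b = {u \<in> Linf T B.
     \<exists>c::nat \<Rightarrow> real. \<forall>t\<in>{0..T}. \<forall>x. u t x = (\<Sum>i<n. c i * b i t x)}"

text \<open>
  The scheme feeds the operator with its own random output. The arguments of the operator are
  therefore \<open>L\<close>-valued, \<open>G\<close>-measurable random functions; the deterministic elements of \<open>L\<close> are
  the constant ones.
\<close>

definition random_elements ::
  "'w measure \<Rightarrow> 'w measure \<Rightarrow> (real \<Rightarrow> real^'d \<Rightarrow> real) set \<Rightarrow> ('w \<Rightarrow> real \<Rightarrow> real^'d \<Rightarrow> real) set" where
  "random_elements M G L = {u. (\<forall>\<omega>\<in>space M. u \<omega> \<in> L) \<and>
     (\<lambda>((t, x), \<omega>). u \<omega> t x) \<in> borel_measurable (borel \<Otimes>\<^sub>M G)}"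

text \<open>
  The error of the operator \<open>A u u' \<omega>\<close>, uniformly over its arguments. These range over the random
  elements, and \<open>EV\<close> is evaluated with its arguments frozen at \<open>\<omega>\<close>. A supremum over
  deterministic arguments alone does not control the error at arguments which depend on the same
  randomness as \<open>A\<close>. The operator acts at times \<open>t < T\<close>.
\<close>

definition operator_error ::
  "'w measure \<Rightarrow> 'w measure \<Rightarrow> real \<Rightarrow> (real \<Rightarrow> real^'d \<Rightarrow> real) set \<Rightarrow>
   (real \<Rightarrow> real^'d \<Rightarrow> (real \<Rightarrow> real^'d \<Rightarrow> real) \<Rightarrow> (real \<Rightarrow> real^'d \<Rightarrow> real) \<Rightarrow> real) \<Rightarrow>
   ((real \<Rightarrow> real^'d \<Rightarrow> real) \<Rightarrow> (real \<Rightarrow> real^'d \<Rightarrow> real) \<Rightarrow> 'w \<Rightarrow> real \<Rightarrow> real^'d \<Rightarrow> real) \<Rightarrow> ennreal" where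
  "operator_error M G T L EV A =
     (SUP (t, x)\<in>{0..<T} \<times> UNIV. SUP u\<in>random_elements M G L. SUP u'\<in>random_elements M G L.
        \<integral>\<^sup>+\<omega>. ennreal \<bar>EV t x (u \<omega>) (u' \<omega>) - A (u \<omega>) (u' \<omega>) \<omega> t x\<bar> \<partial>M)"

text \<open>
  The membership conditions say that the scheme is well posed: the operator is only applied to
  arguments in its domain \<open>L\<close>.
\<close>

definition numerical_iterates ::
  "'w measure \<Rightarrow> real \<Rightarrow> real \<Rightarrow> nat \<Rightarrow> real \<Rightarrow> real \<Rightarrow> (real \<Rightarrow> real^'d \<Rightarrow> real) set \<Rightarrow>
   (real^'d \<Rightarrow> real) \<Rightarrow> (real \<Rightarrow> real^'d \<Rightarrow> real) \<Rightarrow>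
   ((real \<Rightarrow> real^'d \<Rightarrow> real) \<Rightarrow> (real \<Rightarrow> real^'d \<Rightarrow> real) \<Rightarrow> 'w \<Rightarrow> real \<Rightarrow> real^'d \<Rightarrow> real) \<Rightarrow>
   (nat \<Rightarrow> 'w \<Rightarrow> real \<Rightarrow> real^'d \<Rightarrow> real) \<Rightarrow> bool" where
  "numerical_iterates M T h N B B' L g y A v \<longleftrightarrow>
     (\<forall>\<omega>\<in>space M. v 0 \<omega> = y \<and>
       (\<forall>m. v m \<omega> \<in> L) \<and> (\<forall>m\<ge>1. \<forall>i<N. frozen T (v m \<omega>) (real (Suc i) * h) \<in> L) \<and>
       (\<forall>m\<ge>1. (\<forall>x. v m \<omega> T x = g x) \<and>
         (\<forall>i<N. \<forall>x.
           v m \<omega> (real i * h) x =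
             clamp_real B (A (frozen T (v m \<omega>) (real (Suc i) * h)) (v (m - 1) \<omega>) \<omega> (real i * h) x) \<and>
           (\<forall>t\<in>{real i * h <..< real (Suc i) * h}.
              v m \<omega> t x =
                clamp_real B' (A (frozen T (v m \<omega>) (real (Suc i) * h)) (v (m - 1) \<omega>) \<omega> t x)))))"

end

theory Submission
  imports Defs
begin

text \<open>
  The branching functional is a product over particles, and each of its factors has a majorant: a
  particle alive at the next grid point contributes a value bounded by \<open>M\<close>, and a dead particle
  contributes the driver, which is bounded by \<open>2 * C\<close> because at most two of the cut-off functions
  \<open>\<phi> j\<close> are nonzero at a time. If two families of factors have the same majorants, then their products
  differ by at most the product of the majorants times the sum of the relative differences of the factors
  (\<open>abs_prod_prod_diff_le\<close>). The relative difference is \<open>\<bar>u - w\<bar> / M\<close> for a living particle and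
  \<open>2 * L * \<bar>u' - w'\<bar>\<close> for a dead one: at most four summands of the driver are affected by a
  change of its argument, which gives \<open>4 * C * L = (2 * L) * (2 * C)\<close>.

  The expectation \<open>EV\<close> is an integral in its own copy of the sample space, with the random arguments
  frozen. By Tonelli, an error of the arguments that is bounded in mean at each fixed point of space-time
  is therefore only multiplied by the expected number of particles weighted by the majorant, that is,
  by \<open>M1 / M\<close> for the first argument and by \<open>2 * L * M2\<close> for the second one (\<open>EV_diff_le\<close>).
  This needs the joint measurability of the branching functional in time, space and both
  randomnesses, which occupies a large part of the text.

  Truncation does not increase the error. At grid points both schemes are truncated at the same level \<open>M\<close>,
  and truncation is 1-Lipschitz. Between grid points the exact scheme is not truncated, but
  the approximate operator takes its values in a class of functions bounded by the truncation level, so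
  that the numerical scheme is not changed by its truncation either. Hence the mean error \<open>D m n\<close> of the
  \<open>m\<close>-th iterate over the last \<open>n\<close> time steps satisfies
  \<open>D m n \<le> max (D m (n - 1)) (err + M1 / M * D m (n - 1) + 2 * L * M2 * D (m - 1) n)\<close>
  and vanishes for \<open>m = 0\<close> or \<open>n = 0\<close>. After adding \<open>err\<close>, this is Pascal's recursion
  with a factor \<open>c = max (M1 / M) (2 * L * M2) 1\<close> in each step, and so
  \<open>err + D m n \<le> err * (m + n choose n) * c ^ (m + n)\<close> (\<open>two_index_recursion_le\<close>).
\<close>

section \<open>Differences of products and of integrals\<close>

text \<open>
  The relative error \<open>d k\<close> is measured in units of the majorant \<open>c k\<close>, so that nothing is divided
  by a majorant; majorants may vanish. Over an infinite set both sides are 0.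
\<close>

lemma abs_prod_diff_le:
  fixes x y c d :: "'k \<Rightarrow> real"
  assumes x: "\<And>k. k \<in> A \<Longrightarrow> \<bar>x k\<bar> \<le> c k" and y: "\<And>k. k \<in> A \<Longrightarrow> \<bar>y k\<bar> \<le> c k"
    and diff: "\<And>k. k \<in> A \<Longrightarrow> \<bar>x k - y k\<bar> \<le> d k * c k"
  shows "\<bar>prod x A - prod y A\<bar> \<le> sum d A * prod c A"
  using assms
proof (induction A rule: infinite_finite_induct)
  case (insert k A)
  have c: "\<bar>prod y A\<bar> \<le> prod c A"
    using insert.prems(2) by (auto simp: abs_prod intro!: prod_mono)
  have "x k * prod x A - y k * prod y A = x k * (prod x A - prod y A) + (x k - y k) * prod y A"
    by (simp add: algebra_simps)
  also have "\<bar>\<dots>\<bar> \<le> \<bar>x k\<bar> * \<bar>prod x A - prod y A\<bar> + \<bar>x k - y k\<bar> * \<bar>prod y A\<bar>"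
    by (metis abs_mult abs_triangle_ineq)
  also have "\<dots> \<le> c k * (sum d A * prod c A) + (d k * c k) * prod c A"
    using insert c by (intro add_mono mult_mono) (auto intro: order_trans[OF abs_ge_zero])
  finally show ?case
    using insert by (simp add: algebra_simps)
qed auto

lemma abs_prod_le:
  fixes x c :: "'k \<Rightarrow> real"
  assumes "\<And>k. k \<in> A \<Longrightarrow> \<bar>x k\<bar> \<le> c k"
  shows "\<bar>prod x A\<bar> \<le> prod c A"
  using assms by (auto simp: abs_prod intro!: prod_mono)

lemma abs_prod_prod_diff_le:
  fixes x y c d :: "'k \<Rightarrow> real"
  assumes "\<And>k. k \<in> A \<union> B \<Longrightarrow> \<bar>x k\<bar> \<le> c k" and "\<And>k. k \<in> A \<union> B \<Longrightarrow> \<bar>y k\<bar> \<le> c k"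
    and "\<And>k. k \<in> A \<union> B \<Longrightarrow> \<bar>x k - y k\<bar> \<le> d k * c k"
  shows "\<bar>prod x A * prod x B - prod y A * prod y B\<bar>
    \<le> (prod c A * prod c B) * (sum d A + sum d B)"
proof -
  have "prod x A * prod x B - prod y A * prod y B
      = (prod x A - prod y A) * prod x B + prod y A * (prod x B - prod y B)"
    by (simp add: algebra_simps)
  also have "\<bar>\<dots>\<bar> \<le> \<bar>prod x A - prod y A\<bar> * \<bar>prod x B\<bar> + \<bar>prod y A\<bar> * \<bar>prod x B - prod y B\<bar>"
    by (metis abs_mult abs_triangle_ineq)
  also have "\<dots> \<le> (sum d A * prod c A) * prod c B + prod c A * (sum d B * prod c B)"
    using assms abs_prod_diff_le[of A x c y d] abs_prod_diff_le[of B x c y d]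
      abs_prod_le[of A y c] abs_prod_le[of B x c]
    by (intro add_mono mult_mono) (auto intro: order_trans[OF abs_ge_zero])
  finally show ?thesis
    by (simp add: algebra_simps)
qed

text \<open>
  If the right-hand side is finite, then \<open>f - g\<close> is integrable, and so \<open>f\<close> and \<open>g\<close> are both integrable
  or both not integrable; in the latter case both integrals have the default value 0.
\<close>

lemma abs_integral_diff_le_nn_integral:
  fixes f g :: "'s \<Rightarrow> real"
  assumes [measurable]: "f \<in> borel_measurable S" "g \<in> borel_measurable S"
  shows "ennreal \<bar>(\<integral>s. f s \<partial>S) - (\<integral>s. g s \<partial>S)\<bar> \<le> (\<integral>\<^sup>+s. ennreal \<bar>f s - g s\<bar> \<partial>S)"
proof (cases "integrable S (\<lambda>s. f s - g s)")
  case True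
  have iff: "integrable S f \<longleftrightarrow> integrable S g"
    using Bochner_Integration.integrable_add[OF True, of g]
      Bochner_Integration.integrable_diff[OF _ True, of f] by auto
  show ?thesis
  proof (cases "integrable S f")
    case True
    with iff have "(\<integral>s. f s \<partial>S) - (\<integral>s. g s \<partial>S) = (\<integral>s. f s - g s \<partial>S)"
      by simp
    then show ?thesis
      using integral_norm_bound_ennreal[OF \<open>integrable S (\<lambda>s. f s - g s)\<close>] by simp
  next
    case False
    with iff show ?thesis
      by (simp add: not_integrable_integral_eq)
  qed
next
  case False
  then have "(\<integral>\<^sup>+s. ennreal \<bar>f s - g s\<bar> \<partial>S) = \<infinity>"
    by (simp add: integrable_iff_bounded not_less_iff_gr_or_eq less_top)
  then show ?thesis by simp
qed


section \<open>Random finite sets, paths and predictable functionals\<close>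

text \<open>
  The functionals \<open>g\<close> in question (sum, product, cardinality) treat infinite sets like the empty set. The
  random set can thus be replaced by a finite one, which takes only countably many values.
\<close>

lemma measurable_random_set:
  fixes A :: "'s \<Rightarrow> 'k::countable set" and g :: "'k set \<Rightarrow> 's \<Rightarrow> 'b"
  assumes pred: "\<And>k. Measurable.pred S (\<lambda>s. k \<in> A s)"
    and sub: "\<And>s. s \<in> space S \<Longrightarrow> A s \<subseteq> K"
    and infinite: "\<And>B s. infinite B \<Longrightarrow> g B s = g {} s"
    and g: "\<And>B. finite B \<Longrightarrow> B \<subseteq> K \<Longrightarrow> g B \<in> measurable S N"
  shows "(\<lambda>s. g (A s) s) \<in> measurable S N"
proof -
  define I where "I = {B. finite B \<and> B \<subseteq> K}"
  define fin where "fin B = (if finite B then B else {})" for B :: "'k set"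
  have I: "countable I"
    unfolding I_def by (rule countable_subset[OF _ countable_Collect_finite]) auto
  note pred[measurable]
  have eq: "Measurable.pred S (\<lambda>s. A s = B)" for B
  proof -
    have "(\<lambda>s. A s = B) = (\<lambda>s. \<forall>k. k \<in> A s \<longleftrightarrow> k \<in> B)"
      by auto
    then show ?thesis by simp
  qed
  have "{s \<in> space S. finite (A s)} = (\<Union>B\<in>Collect finite. {s \<in> space S. A s = B})"
    by auto
  also have "\<dots> \<in> sets S"
    using eq by (intro sets.countable_UN'' countable_Collect_finite) (auto simp: pred_def)
  finally have finite: "Measurable.pred S (\<lambda>s. finite (A s))"
    by (simp add: pred_def)
  have "(\<lambda>s. fin (A s)) \<in> measurable S (count_space I)"
  proof (subst measurable_count_space_eq_countable[OF I], intro conjI ballI)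
    show "(\<lambda>s. fin (A s)) \<in> space S \<rightarrow> I"
      using sub by (auto simp: I_def fin_def)
    fix B assume "B \<in> I"
    then have "(\<lambda>s. fin (A s)) -` {B} \<inter> space S =
        {s \<in> space S. if finite (A s) then A s = B else B = {}}"
      by (auto simp: fin_def I_def)
    also have "\<dots> \<in> sets S"
      using eq finite by measurable
    finally show "(\<lambda>s. fin (A s)) -` {B} \<inter> space S \<in> sets S" .
  qed
  then have "(\<lambda>s. g (fin (A s)) s) \<in> measurable S N"
    by (rule measurable_compose_countable'[where f=g and g="\<lambda>s. fin (A s)", rotated, OF _ I])
      (simp add: g I_def)
  moreover have "g (fin B) s = g B s" for B s
    using infinite[of B s] by (simp add: fin_def)
  ultimately show ?thesis
    by simp
qed

lemma measurable_path_filtration: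
  fixes w :: "'s \<Rightarrow> real \<Rightarrow> real^'d"
  assumes "\<And>r. 0 \<le> r \<Longrightarrow> (\<lambda>s. w s r) \<in> borel_measurable S"
  shows "w \<in> measurable S (path_filtration t)"
  unfolding path_filtration_def generated_def
proof (rule measurable_measure_of)
  fix y :: "(real \<Rightarrow> real^'d) set" assume "y \<in> {(\<lambda>w. w i) -` A \<inter> UNIV | i A. i \<in> {0..t} \<and> A \<in> sets borel}"
  then obtain i A where y: "y = (\<lambda>w. w i) -` A" "i \<in> {0..t}" "A \<in> sets borel"
    by auto
  have "w -` y \<inter> space S = (\<lambda>s. w s i) -` A \<inter> space S"
    using y by auto
  also have "\<dots> \<in> sets S"
    using y assms by (intro measurable_sets[of _ S borel]) auto
  finally show "w -` y \<inter> space S \<in> sets S" .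
qed auto

text \<open>
  The predictable \<open>\<sigma>\<close>-algebra only tests the coordinates of a path, so that a random path is
  measurable into it as soon as each of its coordinates is a random variable. This covers the paths of
  particles, which jump to 0 at death.
\<close>

lemma measurable_predictable:
  fixes w :: "'s \<Rightarrow> real \<Rightarrow> real^'d"
  assumes T: "0 \<le> T"
    and \<sigma>: "\<sigma> \<in> borel_measurable S" "\<And>s. s \<in> space S \<Longrightarrow> \<sigma> s \<in> {0..T}"
    and w: "\<And>r. 0 \<le> r \<Longrightarrow> (\<lambda>s. w s r) \<in> borel_measurable S"
  shows "(\<lambda>s. (\<sigma> s, w s)) \<in> measurable S (predictable T)"
  unfolding predictable_def
proof (rule measurable_measure_of)
  fix y :: "(real \<times> (real \<Rightarrow> real^'d)) set" assume "y \<in> {{0} \<times> A |A. A \<in> sets (path_filtration 0)} \<union>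
      {{s<..t} \<times> A |s t A. 0 \<le> s \<and> s \<le> t \<and> t \<le> T \<and> A \<in> sets (path_filtration s)}"
  then obtain I :: "real set" and r and A :: "(real \<Rightarrow> real^'d) set" where y: "y = I \<times> A" "I \<in> sets borel" "A \<in> sets (path_filtration r)"
    by auto
  have "(\<lambda>s. (\<sigma> s, w s)) -` y \<inter> space S = (\<sigma> -` I \<inter> space S) \<inter> (w -` A \<inter> space S)"
    using y by auto
  also have "\<dots> \<in> sets S"
    using y(2,3) \<sigma>(1) measurable_path_filtration[OF w]
    by (intro sets.Int measurable_sets[of \<sigma> S borel] measurable_sets[of w S "path_filtration r"]) auto
  finally show "(\<lambda>s. (\<sigma> s, w s)) -` y \<inter> space S \<in> sets S" .
qed (use T \<sigma>(2) in \<open>auto simp: greaterThanAtMost_def\<close>)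

text \<open>
  A process with continuous paths may be evaluated at a random time: the time is approximated by its
  rounding to a grid, which has countably many values.
\<close>

lemma measurable_continuous_process:
  fixes W :: "real \<Rightarrow> 'w \<Rightarrow> 'b::{metric_space}"
  assumes W: "\<And>t. 0 \<le> t \<Longrightarrow> W t \<in> borel_measurable P"
    and cont: "\<And>\<omega>. \<omega> \<in> space P \<Longrightarrow> continuous_on {0..} (\<lambda>t. W t \<omega>)"
    and \<tau>: "\<tau> \<in> borel_measurable S" "\<And>s. s \<in> space S \<Longrightarrow> 0 \<le> \<tau> s"
    and \<pi>: "\<pi> \<in> measurable S P"
  shows "(\<lambda>s. W (\<tau> s) (\<pi> s)) \<in> borel_measurable S"
proof (rule borel_measurable_LIMSEQ_metric)
  define grid where "grid n i = real (nat i) / real (Suc n)" for n i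
  show "(\<lambda>s. W (grid n \<lfloor>\<tau> s * real (Suc n)\<rfloor>) (\<pi> s)) \<in> borel_measurable S" for n
  proof (rule measurable_compose_countable[where f="\<lambda>i s. W (grid n i) (\<pi> s)"])
    show "(\<lambda>s. W (grid n i) (\<pi> s)) \<in> borel_measurable S" for i
      by (rule measurable_compose[OF \<pi> W]) (simp add: grid_def)
    show "(\<lambda>s. \<lfloor>\<tau> s * real (Suc n)\<rfloor>) \<in> measurable S (count_space UNIV)"
      using \<tau>(1) by measurable
  qed
  fix s assume s: "s \<in> space S"
  have "(\<lambda>n. grid n \<lfloor>\<tau> s * real (Suc n)\<rfloor>) \<longlonglongrightarrow> \<tau> s"
  proof (rule LIMSEQ_I)
    fix e :: real assume "0 < e"
    then obtain N where N: "inverse (real (Suc N)) < e"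
      using reals_Archimedean by blast
    have "norm (grid n \<lfloor>\<tau> s * real (Suc n)\<rfloor> - \<tau> s) < e" if "N \<le> n" for n
    proof -
      have "real (nat \<lfloor>\<tau> s * real (Suc n)\<rfloor>) = of_int \<lfloor>\<tau> s * real (Suc n)\<rfloor>"
        using \<tau>(2)[OF s] by simp
      then have "\<bar>real (nat \<lfloor>\<tau> s * real (Suc n)\<rfloor>) - \<tau> s * real (Suc n)\<bar> / real (Suc n) \<le> 1 / real (Suc n)"
        by (intro divide_right_mono) linarith+
      also have "\<bar>real (nat \<lfloor>\<tau> s * real (Suc n)\<rfloor>) - \<tau> s * real (Suc n)\<bar> / real (Suc n)
          = \<bar>grid n \<lfloor>\<tau> s * real (Suc n)\<rfloor> - \<tau> s\<bar>"
        unfolding grid_def by (subst abs_div_pos) (simp_all add: diff_divide_distrib)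
      finally have "\<bar>grid n \<lfloor>\<tau> s * real (Suc n)\<rfloor> - \<tau> s\<bar> \<le> inverse (real (Suc n))"
        by (simp only: inverse_eq_divide)
      also have "\<dots> \<le> inverse (real (Suc N))"
        using that by (intro le_imp_inverse_le) auto
      finally show ?thesis using N by simp
    qed
    then show "\<exists>N. \<forall>n\<ge>N. norm (grid n \<lfloor>\<tau> s * real (Suc n)\<rfloor> - \<tau> s) < e"
      by blast
  qed
  then show "(\<lambda>n. W (grid n \<lfloor>\<tau> s * real (Suc n)\<rfloor>) (\<pi> s)) \<longlonglongrightarrow> W (\<tau> s) (\<pi> s)"
    using \<tau>(2)[OF s] measurable_space[OF \<pi> s]
    by (intro continuous_on_tendsto_compose[OF cont]) (auto simp: grid_def)
qed

section \<open>Genealogy of the branching particles\<close>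

lemma Nil_notin_born: "[] \<notin> born T \<xi> \<delta> t"
proof -
  have "[] \<notin> born_gen T \<xi> \<delta> n t" for n
    by (cases "(T, \<xi>, \<delta>, n, t)" rule: born_gen.cases) auto
  then show ?thesis by (auto simp: born_def)
qed

lemma singleton_in_born_iff: "[j] \<in> born T \<xi> \<delta> t \<longleftrightarrow> j = 1"
proof
  assume "[j] \<in> born T \<xi> \<delta> t"
  then obtain n where "[j] \<in> born_gen T \<xi> \<delta> n t"
    by (auto simp: born_def)
  then show "j = 1"
    using Nil_notin_born[of T \<xi> \<delta> T]
    by (cases "(T, \<xi>, \<delta>, n, t)" rule: born_gen.cases) (auto simp: born_def)
qed (auto simp: born_def intro!: bexI[of _ 1])

text \<open>
  Together with \<open>singleton_in_born_iff\<close> and \<open>in_alive_iff\<close>, this replaces the definition by generations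
  with a recursion along the label.
\<close>

lemma snoc_in_born_iff:
  assumes "k \<noteq> []"
  shows "k @ [j] \<in> born T \<xi> \<delta> t \<longleftrightarrow> k \<in> born T \<xi> \<delta> T \<and> 1 \<le> j \<and> j \<le> \<xi> k \<and> death \<delta> k \<le> t"
proof
  assume "k @ [j] \<in> born T \<xi> \<delta> t"
  then obtain n where "k @ [j] \<in> born_gen T \<xi> \<delta> n t"
    by (auto simp: born_def)
  then show "k \<in> born T \<xi> \<delta> T \<and> 1 \<le> j \<and> j \<le> \<xi> k \<and> death \<delta> k \<le> t"
    using assms by (cases "(T, \<xi>, \<delta>, n, t)" rule: born_gen.cases) (auto simp: born_def intro!: bexI)
next
  assume *: "k \<in> born T \<xi> \<delta> T \<and> 1 \<le> j \<and> j \<le> \<xi> k \<and> death \<delta> k \<le> t"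
  then obtain n where "1 \<le> n" "k \<in> born_gen T \<xi> \<delta> n T"
    by (auto simp: born_def)
  then have "k @ [j] \<in> born_gen T \<xi> \<delta> (Suc n) t"
    using * by (cases n) auto
  then show "k @ [j] \<in> born T \<xi> \<delta> t"
    by (auto simp: born_def intro!: bexI[of _ "Suc n"])
qed

lemma in_alive_iff: "k \<in> alive T \<xi> \<delta> t \<longleftrightarrow> k \<in> born T \<xi> \<delta> t \<and> t < death \<delta> k"
proof -
  have "k \<in> alive_gen T \<xi> \<delta> n t \<longleftrightarrow> k \<in> born_gen T \<xi> \<delta> n t \<and> t < death \<delta> k" for n
    by (cases "(T, \<xi>, \<delta>, n, t)" rule: born_gen.cases) auto
  then show ?thesis
    by (auto simp: alive_def born_def)
qed

lemma death_Nil [simp]: "death \<delta> [] = 0"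
  by (simp add: death.simps)

lemma death_snoc [simp]: "death \<delta> (k @ [j]) = \<delta> (k @ [j]) + death \<delta> k"
  by (subst death.simps) simp

lemma death_singleton [simp]: "death \<delta> [j] = \<delta> [j]"
  using death_snoc[of \<delta> "[]" j] by simp

lemma labels_singleton: "[j] \<in> labels l \<longleftrightarrow> j = 1"
  by (auto simp: labels_def)

lemma labels_snoc: "k \<noteq> [] \<Longrightarrow> k @ [j] \<in> labels l \<longleftrightarrow> k \<in> labels l \<and> j \<le> l"
  by (cases k) (auto simp: labels_def)

lemma Nil_notin_labels: "[] \<notin> labels l"
  by (simp add: labels_def)

lemma branch_path_singleton:
  "branch_path W \<delta> [j] s = (if 0 \<le> s \<and> s \<le> death \<delta> [j] then W [j] s else 0)"
  by (subst branch_path.simps) (auto simp: indicator_def)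

lemma branch_path_snoc:
  assumes "k \<noteq> []"
  shows "branch_path W \<delta> (k @ [j]) s =
    (if 0 \<le> s \<and> s \<le> death \<delta> (k @ [j]) then
       branch_path W \<delta> k (min s (death \<delta> k)) +
       (if j = 0 then 0 else W (k @ [j]) (max s (death \<delta> k)) - W (k @ [j]) (death \<delta> k))
     else 0)"
proof -
  have "\<not> length (k @ [j]) \<le> 1"
    using assms by (cases k) auto
  then show ?thesis
    by (subst branch_path.simps) (simp add: indicator_def Let_def)
qed

section \<open>Random fields\<close>

text \<open>
  The random functions of time and space which the schemes produce. Deterministic functions are treated as
  constant random fields, so that the exact scheme and the numerical one share all measurability
  lemmas.
\<close>

definition random_field ::
  "'w measure \<Rightarrow> ('w \<Rightarrow> real \<Rightarrow> 'x::topological_space \<Rightarrow> real) \<Rightarrow> bool" where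
  "random_field G u \<longleftrightarrow> (\<lambda>((t, x), \<omega>). u \<omega> t x) \<in> borel_measurable (borel \<Otimes>\<^sub>M G)"

lemma random_field_compose:
  fixes \<zeta> :: "'s \<Rightarrow> 'x::second_countable_topology"
  assumes u: "random_field G u" and [measurable]: "\<tau> \<in> borel_measurable S" "\<zeta> \<in> borel_measurable S"
      "\<pi> \<in> measurable S G"
  shows "(\<lambda>s. u (\<pi> s) (\<tau> s) (\<zeta> s)) \<in> borel_measurable S"
proof -
  have "(\<lambda>s. ((\<tau> s, \<zeta> s), \<pi> s)) \<in> measurable S (borel \<Otimes>\<^sub>M G)"
    by (intro measurable_Pair borel_measurable_Pair) measurable
  from measurable_compose[OF this u[unfolded random_field_def]] show ?thesis
    by simp
qed

lemma random_fieldI: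
  fixes u :: "'w \<Rightarrow> real \<Rightarrow> 'x::second_countable_topology \<Rightarrow> real"
  assumes "(\<lambda>s. u (snd s) (fst (fst s)) (snd (fst s))) \<in> borel_measurable (borel \<Otimes>\<^sub>M G)"
  shows "random_field G u"
  using assms by (simp add: random_field_def case_prod_beta')

lemma measurable_time_space:
  "(\<lambda>s. fst (fst s)) \<in> borel_measurable ((borel :: (real \<times> 'x::second_countable_topology) measure) \<Otimes>\<^sub>M G)"
  "(\<lambda>s. snd (fst s)) \<in> borel_measurable ((borel :: (real \<times> 'x::second_countable_topology) measure) \<Otimes>\<^sub>M G)"
  unfolding borel_prod[symmetric] by measurable

lemma random_field_cong:
  assumes "\<And>\<omega> t x. \<omega> \<in> space G \<Longrightarrow> u \<omega> t x = w \<omega> t x"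
  shows "random_field G u \<longleftrightarrow> random_field G w"
  unfolding random_field_def
  by (rule measurable_cong) (use assms in \<open>auto simp: space_pair_measure\<close>)

lemma random_field_coarser:
  assumes "sets G \<subseteq> sets P" "space G = space P" "random_field G u"
  shows "random_field P u"
proof -
  have "id \<in> measurable P G"
    using assms(1,2) by (auto simp: measurable_def)
  then have "(\<lambda>(z, \<omega>). (z, id \<omega>)) \<in> measurable (borel \<Otimes>\<^sub>M P) (borel \<Otimes>\<^sub>M G)"
    by measurable
  from measurable_compose[OF this assms(3)[unfolded random_field_def]] show ?thesis
    by (simp add: random_field_def case_prod_beta')
qed

lemma random_field_frozen:
  fixes u :: "'w \<Rightarrow> real \<Rightarrow> real^'d \<Rightarrow> real"
  assumes u: "random_field G u"
  shows "random_field G (\<lambda>\<omega>. frozen T (u \<omega>) s)"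
proof (rule random_fieldI)
  note measurable_time_space[measurable]
  have [measurable]: "(\<lambda>z :: (real \<times> (real^'d)) \<times> 'w. u (snd z) s (snd (fst z))) \<in> borel_measurable (borel \<Otimes>\<^sub>M G)"
    by (rule random_field_compose[OF u, where \<tau>="\<lambda>_. s"]) (simp_all add: measurable_time_space)
  show "(\<lambda>z. frozen T (u (snd z)) s (fst (fst z)) (snd (fst z))) \<in> borel_measurable (borel \<Otimes>\<^sub>M G)"
    unfolding frozen_def by measurable
qed

text \<open>
  Measurability of an iterate is obtained backward in time: on each time step the iterate is a function
  \<open>c\<close> or \<open>c'\<close> (a truncation or the identity) of a field \<open>R i\<close> which is measurable once the iterate is measurable at the end of that
  step. Both the exact and the numerical scheme have this form.
\<close>

lemma random_field_scheme:
  fixes w :: "'w \<Rightarrow> real \<Rightarrow> real^'d \<Rightarrow> real"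
  assumes h: "0 < h" and T: "real N * h = T"
    and g: "g \<in> borel_measurable borel" and c: "c \<in> borel_measurable borel" and c': "c' \<in> borel_measurable borel"
    and R: "\<And>i. i < N \<Longrightarrow> random_field G (\<lambda>\<omega>. frozen T (w \<omega>) (real (Suc i) * h)) \<Longrightarrow> random_field G (R i)"
    and terminal: "\<And>\<omega> x. \<omega> \<in> space G \<Longrightarrow> w \<omega> T x = g x"
    and grid: "\<And>i \<omega> x. i < N \<Longrightarrow> \<omega> \<in> space G \<Longrightarrow> w \<omega> (real i * h) x = c (R i \<omega> (real i * h) x)"
    and inner: "\<And>i \<omega> t x. i < N \<Longrightarrow> \<omega> \<in> space G \<Longrightarrow> t \<in> {real i * h <..< real (Suc i) * h} \<Longrightarrow>
      w \<omega> t x = c' (R i \<omega> t x)"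
  shows "random_field G (\<lambda>\<omega> t x. if t \<in> {0..T} then w \<omega> t x else 0)"
proof -
  define from_time where "from_time i \<omega> t x = (if t \<in> {real i * h..T} then w \<omega> t x else 0)" for i \<omega> t x
  note measurable_time_space[measurable]
  have "random_field G (from_time (N - n))" if "n \<le> N" for n
    using that
  proof (induction n)
    case 0
    have "random_field G (\<lambda>\<omega> t x. if t = T then g x else 0)"
      by (rule random_fieldI) (use g in measurable)
    then show ?case
      by (subst random_field_cong) (auto simp: from_time_def T terminal)
  next
    case (Suc n)
    define i where "i = N - Suc n"
    have i: "i < N" "N - n = Suc i"
      using Suc.prems by (auto simp: i_def)
    have IH: "random_field G (from_time (Suc i))"
      using Suc i by simp
    have i_le: "real (Suc i) * h \<le> T"
      unfolding T[symmetric] using i(1) h by (intro mult_right_mono) auto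
    have "random_field G (\<lambda>\<omega>. frozen T (w \<omega>) (real (Suc i) * h))"
    proof (subst random_field_cong)
      show "random_field G (\<lambda>\<omega>. frozen T (from_time (Suc i) \<omega>) (real (Suc i) * h))"
        by (rule random_field_frozen[OF IH])
    qed (use i_le in \<open>auto simp: frozen_def from_time_def\<close>)
    then have Ri: "random_field G (R i)"
      by (rule R[OF i(1)])
    have [measurable]: "(\<lambda>z. R i (snd z) (fst (fst z)) (snd (fst z))) \<in> borel_measurable (borel \<Otimes>\<^sub>M G)"
      using Ri by (simp add: random_field_def case_prod_beta')
    have [measurable]: "(\<lambda>z. from_time (Suc i) (snd z) (fst (fst z)) (snd (fst z))) \<in> borel_measurable (borel \<Otimes>\<^sub>M G)"
      using IH by (simp add: random_field_def case_prod_beta')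
    note c[measurable] c'[measurable]
    have "random_field G (\<lambda>\<omega> t x. if t < real i * h then 0 else if t = real i * h then c (R i \<omega> t x)
        else if t < real (Suc i) * h then c' (R i \<omega> t x) else from_time (Suc i) \<omega> t x)"
      by (rule random_fieldI) measurable
    then show ?case
    proof (subst random_field_cong)
      fix \<omega> t x assume \<omega>: "\<omega> \<in> space G"
      have "real i * h < real (Suc i) * h"
        using h by simp
      then show "from_time (N - Suc n) \<omega> t x = (if t < real i * h then 0 else if t = real i * h then c (R i \<omega> t x)
        else if t < real (Suc i) * h then c' (R i \<omega> t x) else from_time (Suc i) \<omega> t x)"
        using grid[OF i(1) \<omega>] inner[OF i(1) \<omega>] i_le unfolding i_def[symmetric] from_time_def
        by (auto simp del: of_nat_Suc)
    qed
  qed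
  from this[of N] show ?thesis
    by (simp add: from_time_def[abs_def])
qed

section \<open>Joint measurability of the branching functional\<close>

text \<open>
  The particle system together with the data of the driver. By \<open>survival\<close>,
  \<open>tail_integral \<rho>\<close> is nonnegative and monotone on the nonnegative half-line.
\<close>

locale branching_diffusion = prob_space P for P :: "'w measure" +
  fixes T h M C L :: real and l0 j0 :: nat
    and a :: "nat \<Rightarrow> nat \<Rightarrow> real^'d::finite \<Rightarrow> real" and \<phi> :: "nat \<Rightarrow> real \<Rightarrow> real"
    and p :: "nat \<Rightarrow> real" and \<rho> :: "real \<Rightarrow> real"
    and \<Phi> :: "real^'d \<Rightarrow> real \<Rightarrow> (real \<Rightarrow> real^'d) \<Rightarrow> real^'d"
    and Wk :: "nat list \<Rightarrow> real \<Rightarrow> 'w \<Rightarrow> real^'d"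
    and \<xi> :: "nat list \<Rightarrow> 'w \<Rightarrow> nat" and \<delta> :: "nat list \<Rightarrow> 'w \<Rightarrow> real"
  assumes h_pos: "0 < h" and h_le: "h \<le> T" and M_pos: "0 < M" and C_nonneg: "0 \<le> C"
    and a_cont: "\<And>j l. j \<in> {1..j0} \<Longrightarrow> l \<le> l0 \<Longrightarrow> continuous_on UNIV (a j l)"
    and a_bound: "\<And>j l x. j \<in> {1..j0} \<Longrightarrow> l \<le> l0 \<Longrightarrow> \<bar>a j l x\<bar> \<le> C"
    and L_nonneg: "0 \<le> L"
    and \<phi>_lipschitz: "\<And>j. j \<in> {1..j0} \<Longrightarrow> L-lipschitz_on UNIV (\<phi> j)"
    and \<phi>_bound: "\<And>j z. j \<in> {1..j0} \<Longrightarrow> \<bar>\<phi> j z\<bar> \<le> 1"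
    and \<phi>_card: "\<And>z. card {j \<in> {1..j0}. \<phi> j z \<noteq> 0} \<le> 2"
    and p_nonneg: "\<And>l. l \<le> l0 \<Longrightarrow> 0 \<le> p l"
    and \<rho>_cont: "continuous_on {0..} \<rho>" and \<rho>_nonneg: "\<And>t. 0 \<le> t \<Longrightarrow> 0 \<le> \<rho> t"
    and W_meas: "\<And>k t. k \<in> labels l0 \<Longrightarrow> 0 \<le> t \<Longrightarrow> Wk k t \<in> borel_measurable P"
    and W_cont: "\<And>k \<omega>. k \<in> labels l0 \<Longrightarrow> \<omega> \<in> space P \<Longrightarrow> continuous_on {0..} (\<lambda>t. Wk k t \<omega>)"
    and \<xi>_meas: "\<And>k. k \<in> labels l0 \<Longrightarrow> \<xi> k \<in> measurable P (count_space UNIV)"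
    and \<xi>_le: "\<And>k \<omega>. k \<in> labels l0 \<Longrightarrow> \<omega> \<in> space P \<Longrightarrow> \<xi> k \<omega> \<le> l0"
    and \<delta>_meas: "\<And>k. k \<in> labels l0 \<Longrightarrow> \<delta> k \<in> borel_measurable P"
    and \<delta>_nonneg: "\<And>k \<omega>. k \<in> labels l0 \<Longrightarrow> \<omega> \<in> space P \<Longrightarrow> 0 \<le> \<delta> k \<omega>"
    and survival: "\<And>k t. k \<in> labels l0 \<Longrightarrow> 0 \<le> t \<Longrightarrow>
      measure P {\<omega> \<in> space P. t < \<delta> k \<omega>} = tail_integral \<rho> t"
    and \<Phi>_meas: "(\<lambda>(x, s, w). \<Phi> x s w) \<in> borel_measurable (borel \<Otimes>\<^sub>M predictable T)"
begin

abbreviation "K \<equiv> labels l0"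
abbreviation "death_at k \<omega> \<equiv> death (\<lambda>k. \<delta> k \<omega>) k"
abbreviation "born_at t \<omega> \<equiv> born T (\<lambda>k. \<xi> k \<omega>) (\<lambda>k. \<delta> k \<omega>) t"
abbreviation "alive_at t \<omega> \<equiv> alive T (\<lambda>k. \<xi> k \<omega>) (\<lambda>k. \<delta> k \<omega>) t"
abbreviation "dead_at t \<omega> \<equiv> born_at t \<omega> - alive_at t \<omega>"
abbreviation "majorant_at t \<omega> \<equiv> majorant T C M p \<rho> (\<lambda>k. \<xi> k \<omega>) (\<lambda>k. \<delta> k \<omega>) t"
abbreviation "position x k s \<omega> \<equiv> \<Phi> x s (branch_path (\<lambda>k s. Wk k s \<omega>) (\<lambda>k. \<delta> k \<omega>) k)"
abbreviation "V t x u u' \<omega> \<equiv> branch_op T h j0 a \<phi> p \<rho> \<Phi>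
  (\<lambda>k s. Wk k s \<omega>) (\<lambda>k. \<xi> k \<omega>) (\<lambda>k. \<delta> k \<omega>) t x u u'"
abbreviation "next_grid t \<equiv> (of_int \<lfloor>t / h\<rfloor> + 1) * h"
abbreviation "driver l x z \<equiv> \<Sum>j=1..j0. a j l x * \<phi> j z"

lemma next_grid: "t < next_grid t" "next_grid t \<le> t + h"
proof -
  have "t / h < of_int \<lfloor>t / h\<rfloor> + 1" "of_int \<lfloor>t / h\<rfloor> \<le> t / h"
    by linarith+
  then have "t / h * h < next_grid t" "of_int \<lfloor>t / h\<rfloor> * h \<le> t / h * h"
    using h_pos by (intro mult_strict_right_mono mult_right_mono; simp)+
  then show "t < next_grid t" "next_grid t \<le> t + h"
    using h_pos by (simp_all add: algebra_simps)
qed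

lemma measurable_next_grid [measurable]: "next_grid \<in> borel_measurable borel"
  by measurable

lemma death_nonneg: "k \<in> K \<Longrightarrow> \<omega> \<in> space P \<Longrightarrow> 0 \<le> death_at k \<omega>"
proof (induction k rule: rev_induct)
  case (snoc j k)
  then show ?case
    using \<delta>_nonneg[of "k @ [j]" \<omega>] by (cases "k = []") (auto simp: labels_snoc)
qed simp

lemma measurable_death: "k \<in> K \<Longrightarrow> death_at k \<in> borel_measurable P"
proof (induction k rule: rev_induct)
  case (snoc j k)
  then show ?case
    using \<delta>_meas[of "k @ [j]"] by (cases "k = []") (auto simp: labels_snoc)
qed simp

lemma born_subset_labels: "\<omega> \<in> space P \<Longrightarrow> k \<in> born_at t \<omega> \<Longrightarrow> k \<in> K"
proof (induction k arbitrary: t rule: rev_induct)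
  case (snoc j k)
  show ?case
  proof (cases "k = []")
    case True
    with snoc.prems show ?thesis
      by (simp add: singleton_in_born_iff labels_singleton)
  next
    case False
    with snoc show ?thesis
      using \<xi>_le[of k \<omega>] by (auto simp: snoc_in_born_iff labels_snoc)
  qed
qed (simp add: Nil_notin_born)

lemma alive_subset_labels: "\<omega> \<in> space P \<Longrightarrow> k \<in> alive_at t \<omega> \<Longrightarrow> k \<in> K"
  using born_subset_labels by (auto simp: in_alive_iff)

lemma parent_death_le:
  assumes "\<omega> \<in> space P" "k \<in> born_at t \<omega>" "0 \<le> t"
  shows "death_at (butlast k) \<omega> \<le> t"
  using assms(2,3)
  by (cases k rule: rev_cases; cases "butlast k = []")
    (auto simp: snoc_in_born_iff)

text \<open>
  Every particle born before \<open>t\<close>, except for the first one, has a dead parent, and a parent has at most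
  \<open>l0\<close> children. Hence infinitely many births entail infinitely many deaths, and the number of dead
  particles is bounded by the number of births even though \<open>card\<close> is 0 on infinite sets.
\<close>

lemma finite_born:
  assumes \<omega>: "\<omega> \<in> space P" and "finite (dead_at t \<omega>)"
  shows "finite (born_at t \<omega>)"
proof (rule finite_subset)
  show "finite (insert [1] ((\<lambda>(k, j). k @ [j]) ` (dead_at t \<omega> \<times> {1..l0})))"
    using assms by simp
  show "born_at t \<omega> \<subseteq> insert [1] ((\<lambda>(k, j). k @ [j]) ` (dead_at t \<omega> \<times> {1..l0}))"
  proof
    fix k' assume k': "k' \<in> born_at t \<omega>"
    show "k' \<in> insert [1] ((\<lambda>(k, j). k @ [j]) ` (dead_at t \<omega> \<times> {1..l0}))"
    proof (cases k' rule: rev_cases)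
      case Nil
      with k' show ?thesis by (simp add: Nil_notin_born)
    next
      case (snoc k j)
      show ?thesis
      proof (cases "k = []")
        case True
        with k' snoc show ?thesis by (simp add: singleton_in_born_iff)
      next
        case False
        with k' snoc have k: "k \<in> born_at T \<omega>" "1 \<le> j" "j \<le> \<xi> k \<omega>" "death_at k \<omega> \<le> t"
          by (auto simp: snoc_in_born_iff)
        \<comment> \<open>The definition gives birth before \<open>T\<close>; birth before \<open>t\<close> follows from \<open>\<delta> k \<ge> 0\<close>.\<close>
        have "k \<in> born_at t \<omega>"
        proof (cases k rule: rev_cases)
          case (snoc k0 i)
          show ?thesis
          proof (cases "k0 = []")
            case True
            with snoc k show ?thesis by (simp add: singleton_in_born_iff)
          next
            case False
            moreover have "death_at k0 \<omega> \<le> death_at k \<omega>"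
              using \<delta>_nonneg[OF born_subset_labels[OF \<omega> k(1)] \<omega>] snoc by simp
            ultimately show ?thesis
              using k snoc by (auto simp: snoc_in_born_iff)
          qed
        qed (use False in simp)
        then have "k \<in> dead_at t \<omega>"
          using k by (auto simp: in_alive_iff)
        moreover have "j \<le> l0"
          using k \<xi>_le[OF born_subset_labels[OF \<omega> k(1)] \<omega>] by simp
        ultimately show ?thesis
          using k snoc by auto
      qed
    qed
  qed
qed

lemma pred_born:
  assumes \<pi>: "\<pi> \<in> measurable S P" and "\<tau> \<in> borel_measurable S"
  shows "Measurable.pred S (\<lambda>s. k \<in> born_at (\<tau> s) (\<pi> s))"
  using assms(2)
proof (induction k arbitrary: \<tau> rule: rev_induct)
  case (snoc j k)
  note [measurable] = snoc.prems
  show ?case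
  proof (cases "k = []")
    case False
    show ?thesis
    proof (cases "k \<in> K")
      case True
      have [measurable]: "(\<lambda>s. \<xi> k (\<pi> s)) \<in> measurable S (count_space UNIV)"
        "(\<lambda>s. death_at k (\<pi> s)) \<in> borel_measurable S"
        using measurable_compose[OF \<pi> \<xi>_meas] measurable_compose[OF \<pi> measurable_death] True by auto
      have [measurable]: "Measurable.pred S (\<lambda>s. k \<in> born_at T (\<pi> s))"
        by (rule snoc.IH) simp
      show ?thesis
        unfolding snoc_in_born_iff[OF False] by measurable
    next
      case nK: False
      have "k @ [j] \<notin> born_at (\<tau> s) (\<pi> s)" if "s \<in> space S" for s
        using nK born_subset_labels[OF measurable_space[OF \<pi> that]] snoc_in_born_iff[OF False]
        by metis
      then show ?thesis
        by (subst measurable_cong[where g="\<lambda>_. False"]) auto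
    qed
  qed (simp add: singleton_in_born_iff)
qed (simp add: Nil_notin_born)

lemma pred_alive:
  assumes \<pi>: "\<pi> \<in> measurable S P" and \<tau>: "\<tau> \<in> borel_measurable S"
  shows "Measurable.pred S (\<lambda>s. k \<in> alive_at (\<tau> s) (\<pi> s))"
proof (cases "k \<in> K")
  case True
  note pred_born[OF assms, measurable] \<tau>[measurable]
  have [measurable]: "(\<lambda>s. death_at k (\<pi> s)) \<in> borel_measurable S"
    using measurable_compose[OF \<pi> measurable_death] True by auto
  show ?thesis
    unfolding in_alive_iff by measurable
next
  case False
  then have "k \<notin> alive_at (\<tau> s) (\<pi> s)" if "s \<in> space S" for s
    using alive_subset_labels[OF measurable_space[OF \<pi> that]] by auto
  then show ?thesis
    by (subst measurable_cong[where g="\<lambda>_. False"]) auto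
qed

lemma pred_dead:
  assumes "\<pi> \<in> measurable S P" and "\<tau> \<in> borel_measurable S"
  shows "Measurable.pred S (\<lambda>s. k \<in> dead_at (\<tau> s) (\<pi> s))"
proof -
  note pred_born[OF assms, measurable] pred_alive[OF assms, measurable]
  show ?thesis unfolding Diff_iff by measurable
qed

lemma measurable_branch_path:
  assumes "k \<in> K" and \<pi>: "\<pi> \<in> measurable S P"
    and "\<sigma> \<in> borel_measurable S" "\<And>s. s \<in> space S \<Longrightarrow> 0 \<le> \<sigma> s"
  shows "(\<lambda>s. branch_path (\<lambda>k r. Wk k r (\<pi> s)) (\<lambda>k. \<delta> k (\<pi> s)) k (\<sigma> s)) \<in> borel_measurable S"
  using assms(1,3,4)
proof (induction k arbitrary: \<sigma> rule: rev_induct)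
  case (snoc j k)
  note [measurable] = snoc.prems(2)
  have W [measurable]: "(\<lambda>s. Wk (k @ [j]) (\<tau> s) (\<pi> s)) \<in> borel_measurable S"
    if "\<tau> \<in> borel_measurable S" "\<And>s. s \<in> space S \<Longrightarrow> 0 \<le> \<tau> s" for \<tau>
    by (rule measurable_continuous_process[OF W_meas W_cont that \<pi>]) (use snoc.prems(1) in auto)
  have [measurable]: "(\<lambda>s. death_at (k @ [j]) (\<pi> s)) \<in> borel_measurable S"
    by (rule measurable_compose[OF \<pi> measurable_death[OF snoc.prems(1)]])
  show ?case
  proof (cases "k = []")
    case True
    then show ?thesis
      using snoc.prems W[OF snoc.prems(2,3)] \<open>(\<lambda>s. death_at (k @ [j]) (\<pi> s)) \<in> borel_measurable S\<close>
      unfolding append_Nil branch_path_singleton True by measurable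
  next
    case False
    then have k: "k \<in> K"
      using snoc.prems(1) by (simp add: labels_snoc)
    have d [measurable]: "(\<lambda>s. death_at k (\<pi> s)) \<in> borel_measurable S"
      by (rule measurable_compose[OF \<pi> measurable_death[OF k]])
    have d0: "0 \<le> death_at k (\<pi> s)" if "s \<in> space S" for s
      by (rule death_nonneg[OF k measurable_space[OF \<pi> that]])
    have [measurable]: "(\<lambda>s. branch_path (\<lambda>k r. Wk k r (\<pi> s)) (\<lambda>k. \<delta> k (\<pi> s)) k
        (min (\<sigma> s) (death_at k (\<pi> s)))) \<in> borel_measurable S"
      using snoc.prems(3) d0 by (intro snoc.IH k) auto
    have [measurable]: "(\<lambda>s. Wk (k @ [j]) (max (\<sigma> s) (death_at k (\<pi> s))) (\<pi> s)) \<in> borel_measurable S"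
      using snoc.prems(3) by (intro W) (auto simp: le_max_iff_disj)
    have [measurable]: "(\<lambda>s. Wk (k @ [j]) (death_at k (\<pi> s)) (\<pi> s)) \<in> borel_measurable S"
      using d0 by (intro W d) auto
    show ?thesis
      unfolding branch_path_snoc[OF False] by measurable
  qed
qed (simp add: Nil_notin_labels)

lemma measurable_position:
  assumes k: "k \<in> K" and \<pi>: "\<pi> \<in> measurable S P" and \<zeta>: "\<zeta> \<in> borel_measurable S"
    and \<sigma>: "\<sigma> \<in> borel_measurable S" "\<And>s. s \<in> space S \<Longrightarrow> \<sigma> s \<in> {0..T}"
  shows "(\<lambda>s. position (\<zeta> s) k (\<sigma> s) (\<pi> s)) \<in> borel_measurable S"
proof -
  have "(\<lambda>s. (\<sigma> s, branch_path (\<lambda>k r. Wk k r (\<pi> s)) (\<lambda>k. \<delta> k (\<pi> s)) k)) \<in> measurable S (predictable T)"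
    using h_pos h_le by (intro measurable_predictable[OF _ \<sigma>] measurable_branch_path[OF k \<pi>]) auto
  then have "(\<lambda>s. (\<zeta> s, \<sigma> s, branch_path (\<lambda>k r. Wk k r (\<pi> s)) (\<lambda>k. \<delta> k (\<pi> s)) k))
      \<in> measurable S (borel \<Otimes>\<^sub>M predictable T)"
    using \<zeta> by (intro measurable_Pair) auto
  from measurable_compose[OF this \<Phi>_meas] show ?thesis
    by simp
qed

lemma tail_integral_nonneg: "0 \<le> t \<Longrightarrow> 0 \<le> tail_integral \<rho> t"
  using survival[of "[1]" t] by (metis labels_singleton measure_nonneg)

lemma measurable_tail_integral [measurable]:
  "(\<lambda>t. tail_integral \<rho> (max 0 t)) \<in> borel_measurable borel"
proof -
  have 1: "[1] \<in> K" by (simp add: labels_singleton)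
  note \<delta>_meas[OF 1, measurable]
  have "mono (\<lambda>t. - tail_integral \<rho> (max 0 t))"
  proof (rule monoI)
    fix s t :: real assume "s \<le> t"
    then have "measure P {\<omega> \<in> space P. max 0 t < \<delta> [1] \<omega>} \<le> measure P {\<omega> \<in> space P. max 0 s < \<delta> [1] \<omega>}"
    proof (intro finite_measure_mono)
      show "{\<omega> \<in> space P. max 0 s < \<delta> [1] \<omega>} \<in> events"
        by measurable
    qed auto
    then show "- tail_integral \<rho> (max 0 s) \<le> - tail_integral \<rho> (max 0 t)"
      by (simp only: survival[OF 1 max.cobounded1] neg_le_iff_le)
  qed
  from borel_measurable_uminus[OF borel_measurable_mono[OF this]] show ?thesis
    by simp
qed

lemma measurable_\<rho>: "(\<lambda>t. \<rho> (max 0 t)) \<in> borel_measurable borel"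
  by (intro borel_measurable_continuous_onI continuous_on_compose2[OF \<rho>_cont]) (auto intro!: continuous_intros)

text \<open>
  The particles are evaluated at \<open>\<pi>\<close> and the arguments at \<open>\<pi>'\<close>, since \<open>EV\<close> integrates over
  the particles with the arguments frozen. The factors of a particle are first modified so that times stay in
  the range in which \<open>\<Phi>\<close>, \<open>\<rho>\<close> and \<open>tail_integral \<rho>\<close> are known to be measurable; on the sets of
  living and dead particles this modification has no effect.
\<close>

lemma measurable_V:
  assumes \<pi>: "\<pi> \<in> measurable S P" and \<pi>': "\<pi>' \<in> measurable S G"
    and \<tau> [measurable]: "\<tau> \<in> borel_measurable S" and \<zeta>: "\<zeta> \<in> borel_measurable S"
    and u: "random_field G u" and u': "random_field G u'"
  shows "(\<lambda>s. V (\<tau> s) (\<zeta> s) (u (\<pi>' s)) (u' (\<pi>' s)) (\<pi> s)) \<in> borel_measurable S"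
proof -
  define lag where "lag s = next_grid (\<tau> s) - \<tau> s" for s
  have lag [measurable]: "lag \<in> borel_measurable S"
    unfolding lag_def by measurable
  have lag_bounds: "0 \<le> lag s" "lag s \<le> T" for s
    using next_grid[of "\<tau> s"] h_le by (auto simp: lag_def)
  have death: "(\<lambda>s. death_at k (\<pi> s)) \<in> borel_measurable S" if "k \<in> insert [] K" for k
    using that measurable_compose[OF \<pi> measurable_death[of k]] by auto
  define f where "f k s = u (\<pi>' s) (next_grid (\<tau> s)) (position (\<zeta> s) k (lag s) (\<pi> s)) /
      tail_integral \<rho> (max 0 (lag s - death_at (butlast k) (\<pi> s)))" for k s
  have f: "f k \<in> borel_measurable S" if "k \<in> K" for k
  proof -
    have "butlast k \<in> insert [] K"
      using that by (cases k rule: rev_cases; cases "butlast k = []") (auto simp: labels_snoc)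
    note death[OF this, measurable]
    have "(\<lambda>s. position (\<zeta> s) k (lag s) (\<pi> s)) \<in> borel_measurable S"
      using lag_bounds by (intro measurable_position that \<pi> \<zeta> lag) auto
    then have [measurable]: "(\<lambda>s. u (\<pi>' s) (next_grid (\<tau> s)) (position (\<zeta> s) k (lag s) (\<pi> s))) \<in> borel_measurable S"
      by (intro random_field_compose[OF u] \<pi>') measurable
    show ?thesis
      unfolding f_def by measurable
  qed
  define b where "b k s = driver (\<xi> k (\<pi> s)) (position (\<zeta> s) k (min (death_at k (\<pi> s)) T) (\<pi> s))
       (u' (\<pi>' s) (\<tau> s + death_at k (\<pi> s)) (position (\<zeta> s) k (min (death_at k (\<pi> s)) T) (\<pi> s))) /
      (p (\<xi> k (\<pi> s)) * \<rho> (max 0 (\<delta> k (\<pi> s))))" for k s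
  have b: "b k \<in> borel_measurable S" if k: "k \<in> K" for k
  proof -
    have \<xi>: "(\<lambda>s. \<xi> k (\<pi> s)) \<in> measurable S (count_space UNIV)"
      by (rule measurable_compose[OF \<pi> \<xi>_meas[OF k]])
    have \<xi>': "(\<lambda>s. \<xi> k (\<pi> s)) \<in> measurable S (count_space {..l0})"
      using \<xi> \<xi>_le[OF k measurable_space[OF \<pi>]]
      by (subst measurable_count_space_eq_countable) (auto simp: measurable_sets)
    have d [measurable]: "(\<lambda>s. death_at k (\<pi> s)) \<in> borel_measurable S"
      using death k by auto
    define X where "X s = position (\<zeta> s) k (min (death_at k (\<pi> s)) T) (\<pi> s)" for s
    have X [measurable]: "X \<in> borel_measurable S"
      unfolding X_def
      using death_nonneg[OF k measurable_space[OF \<pi>]] h_pos h_le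
      by (intro measurable_position k \<pi> \<zeta>) auto
    have [measurable]: "(\<lambda>s. u' (\<pi>' s) (\<tau> s + death_at k (\<pi> s)) (X s)) \<in> borel_measurable S"
      by (intro random_field_compose[OF u'] \<pi>' X) measurable
    have \<phi>: "\<phi> j \<in> borel_measurable borel" if "j \<in> {1..j0}" for j
      by (intro borel_measurable_continuous_onI lipschitz_on_continuous_on[OF \<phi>_lipschitz[OF that]])
    have a: "(\<lambda>s. a j (\<xi> k (\<pi> s)) (X s)) \<in> borel_measurable S" if "j \<in> {1..j0}" for j
    proof (rule measurable_compose_countable'[where f="\<lambda>l s. a j l (X s)", OF _ \<xi>'])
      fix l assume "l \<in> {..l0}"
      then show "(\<lambda>s. a j l (X s)) \<in> borel_measurable S"
        using that by (intro measurable_compose[OF X] borel_measurable_continuous_onI a_cont) auto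
    qed simp
    have [measurable]: "(\<lambda>s. p (\<xi> k (\<pi> s))) \<in> borel_measurable S"
      by (rule measurable_compose[OF \<xi>]) simp
    have [measurable]: "(\<lambda>s. \<rho> (max 0 (\<delta> k (\<pi> s)))) \<in> borel_measurable S"
      by (rule measurable_compose[OF measurable_compose[OF \<pi> \<delta>_meas[OF k]] measurable_\<rho>])
    have [measurable]: "(\<lambda>s. driver (\<xi> k (\<pi> s)) (X s) (u' (\<pi>' s) (\<tau> s + death_at k (\<pi> s)) (X s))) \<in> borel_measurable S"
      by (intro borel_measurable_sum borel_measurable_times a measurable_compose[OF _ \<phi>]) measurable
    show ?thesis
      unfolding b_def X_def[symmetric] by measurable
  qed
  have "(\<lambda>s. (\<Prod>k\<in>alive_at (lag s) (\<pi> s). f k s)) \<in> borel_measurable S"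
  proof (rule measurable_random_set[where g="\<lambda>B s. \<Prod>k\<in>B. f k s" and K=K])
    show "alive_at (lag s) (\<pi> s) \<subseteq> K" if "s \<in> space S" for s
      using alive_subset_labels[OF measurable_space[OF \<pi> that]] by auto
  qed (use f in \<open>auto intro!: pred_alive \<pi> lag borel_measurable_prod\<close>)
  moreover have "(\<lambda>s. (\<Prod>k\<in>dead_at (lag s) (\<pi> s). b k s)) \<in> borel_measurable S"
  proof (rule measurable_random_set[where g="\<lambda>B s. \<Prod>k\<in>B. b k s" and K=K])
    show "dead_at (lag s) (\<pi> s) \<subseteq> K" if "s \<in> space S" for s
      using born_subset_labels[OF measurable_space[OF \<pi> that]] by auto
  qed (use b in \<open>auto intro!: pred_dead[unfolded Diff_iff] \<pi> lag borel_measurable_prod\<close>)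
  ultimately have "(\<lambda>s. (\<Prod>k\<in>alive_at (lag s) (\<pi> s). f k s) * (\<Prod>k\<in>dead_at (lag s) (\<pi> s). b k s)) \<in> borel_measurable S"
    by simp
  also have "?this \<longleftrightarrow> ?thesis"
  proof (rule measurable_cong)
    fix s assume "s \<in> space S"
    then have \<omega>: "\<pi> s \<in> space P"
      by (rule measurable_space[OF \<pi>])
    have "f k s = u (\<pi>' s) (next_grid (\<tau> s)) (position (\<zeta> s) k (lag s) (\<pi> s)) /
        tail_integral \<rho> (lag s - death_at (butlast k) (\<pi> s))" if "k \<in> alive_at (lag s) (\<pi> s)" for k
      using parent_death_le[OF \<omega>, of k "lag s"] lag_bounds[of s] that by (auto simp: f_def in_alive_iff)
    moreover have "b k s = driver (\<xi> k (\<pi> s)) (position (\<zeta> s) k (death_at k (\<pi> s)) (\<pi> s))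
        (u' (\<pi>' s) (\<tau> s + death_at k (\<pi> s)) (position (\<zeta> s) k (death_at k (\<pi> s)) (\<pi> s))) /
        (p (\<xi> k (\<pi> s)) * \<rho> (\<delta> k (\<pi> s)))" if "k \<in> dead_at (lag s) (\<pi> s)" for k
    proof -
      have "death_at k (\<pi> s) \<le> T" "k \<in> K"
        using that lag_bounds[of s] born_subset_labels[OF \<omega>] by (auto simp: in_alive_iff)
      then show ?thesis
        using \<delta>_nonneg[OF _ \<omega>] by (simp add: b_def)
    qed
    ultimately show "(\<Prod>k\<in>alive_at (lag s) (\<pi> s). f k s) * (\<Prod>k\<in>dead_at (lag s) (\<pi> s). b k s) =
        V (\<tau> s) (\<zeta> s) (u (\<pi>' s)) (u' (\<pi>' s)) (\<pi> s)"
      by (simp add: branch_op_def Let_def lag_def)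
  qed
  finally show ?thesis .
qed

lemma measurable_majorant:
  assumes s: "0 \<le> s"
  shows "majorant_at s \<in> borel_measurable P"
proof -
  define f where "f k \<omega> = M / tail_integral \<rho> (max 0 (s - death_at (butlast k) \<omega>))" for k \<omega>
  define b where "b k \<omega> = 2 * C / (p (\<xi> k \<omega>) * \<rho> (max 0 (\<delta> k \<omega>)))" for k \<omega>
  have f: "f k \<in> borel_measurable P" if "k \<in> K" for k
  proof -
    have [measurable]: "death_at (butlast k) \<in> borel_measurable P"
      using that by (cases k rule: rev_cases; cases "butlast k = []")
        (auto simp: labels_snoc measurable_death)
    show ?thesis
      unfolding f_def by measurable
  qed
  have b: "b k \<in> borel_measurable P" if "k \<in> K" for k
  proof -
    note \<xi>_meas[OF that, measurable] measurable_compose[OF \<delta>_meas[OF that] measurable_\<rho>, measurable]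
    show ?thesis
      unfolding b_def by measurable
  qed
  have "(\<lambda>\<omega>. (\<Prod>k\<in>alive_at s \<omega>. f k \<omega>)) \<in> borel_measurable P"
    by (rule measurable_random_set[where g="\<lambda>B \<omega>. \<Prod>k\<in>B. f k \<omega>" and K=K])
      (use f alive_subset_labels in \<open>auto intro!: pred_alive borel_measurable_prod\<close>)
  moreover have "(\<lambda>\<omega>. (\<Prod>k\<in>dead_at s \<omega>. b k \<omega>)) \<in> borel_measurable P"
    by (rule measurable_random_set[where g="\<lambda>B \<omega>. \<Prod>k\<in>B. b k \<omega>" and K=K])
      (use b born_subset_labels in \<open>auto intro!: pred_dead[unfolded Diff_iff] borel_measurable_prod\<close>)
  ultimately have "(\<lambda>\<omega>. (\<Prod>k\<in>alive_at s \<omega>. f k \<omega>) * (\<Prod>k\<in>dead_at s \<omega>. b k \<omega>)) \<in> borel_measurable P"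
    by simp
  also have "?this \<longleftrightarrow> ?thesis"
  proof (rule measurable_cong)
    fix \<omega> assume \<omega>: "\<omega> \<in> space P"
    have "f k \<omega> = M / tail_integral \<rho> (s - death_at (butlast k) \<omega>)" if "k \<in> alive_at s \<omega>" for k
      using parent_death_le[OF \<omega>, of k s] s that by (auto simp: f_def in_alive_iff)
    moreover have "b k \<omega> = 2 * C / (p (\<xi> k \<omega>) * \<rho> (\<delta> k \<omega>))" if "k \<in> dead_at s \<omega>" for k
      using \<delta>_nonneg[OF born_subset_labels[OF \<omega>, of k s] \<omega>] that by (simp add: b_def)
    ultimately show "(\<Prod>k\<in>alive_at s \<omega>. f k \<omega>) * (\<Prod>k\<in>dead_at s \<omega>. b k \<omega>) = majorant_at s \<omega>"
      by (simp add: majorant_def)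
  qed
  finally show ?thesis .
qed

lemma measurable_card_alive: "(\<lambda>\<omega>. of_nat (card (alive_at s \<omega>)) :: ennreal) \<in> borel_measurable P"
  by (rule measurable_random_set[where g="\<lambda>B _. of_nat (card B)" and K=K])
    (use alive_subset_labels in \<open>auto intro!: pred_alive\<close>)

lemma measurable_card_born: "(\<lambda>\<omega>. of_nat (card (born_at s \<omega>)) :: ennreal) \<in> borel_measurable P"
  by (rule measurable_random_set[where g="\<lambda>B _. of_nat (card B)" and K=K])
    (use born_subset_labels in \<open>auto intro!: pred_born\<close>)

section \<open>Sensitivity of the branching functional\<close>

lemma driver_bound:
  assumes l: "l \<le> l0"
  shows "\<bar>driver l x z\<bar> \<le> 2 * C"
proof -
  let ?J = "{j \<in> {1..j0}. \<phi> j z \<noteq> 0}"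
  have "driver l x z = (\<Sum>j\<in>?J. a j l x * \<phi> j z)"
    by (intro sum.mono_neutral_right) auto
  also have "\<bar>\<dots>\<bar> \<le> (\<Sum>j\<in>?J. C * 1)"
  proof (intro order_trans[OF sum_abs] sum_mono)
    fix j assume "j \<in> ?J"
    then show "\<bar>a j l x * \<phi> j z\<bar> \<le> C * 1"
      unfolding abs_mult using a_bound[OF _ l] \<phi>_bound C_nonneg by (intro mult_mono) auto
  qed
  also have "\<dots> = real (card ?J) * C"
    by simp
  also have "\<dots> \<le> 2 * C"
    using \<phi>_card[of z] C_nonneg by (intro mult_right_mono) auto
  finally show ?thesis .
qed

text \<open>
  Only those summands contribute for which \<open>\<phi> j z\<close> or \<open>\<phi> j z'\<close> is nonzero, that is, at most four.
  The bound is written as a relative error times the bound of \<open>driver_bound\<close>.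
\<close>

lemma driver_lipschitz:
  assumes l: "l \<le> l0"
  shows "\<bar>driver l x z - driver l x z'\<bar> \<le> (2 * L * \<bar>z - z'\<bar>) * (2 * C)"
proof -
  let ?J = "\<lambda>z. {j \<in> {1..j0}. \<phi> j z \<noteq> 0}"
  have "driver l x z - driver l x z' = (\<Sum>j=1..j0. a j l x * (\<phi> j z - \<phi> j z'))"
    by (simp add: sum_subtractf right_diff_distrib)
  then have eq: "driver l x z - driver l x z' = (\<Sum>j\<in>?J z \<union> ?J z'. a j l x * (\<phi> j z - \<phi> j z'))"
    by (simp only:) (intro sum.mono_neutral_right; auto)
  have "\<bar>driver l x z - driver l x z'\<bar> \<le> (\<Sum>j\<in>?J z \<union> ?J z'. C * (L * \<bar>z - z'\<bar>))"
    unfolding eq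
  proof (intro order_trans[OF sum_abs] sum_mono)
    fix j assume "j \<in> ?J z \<union> ?J z'"
    then have j: "j \<in> {1..j0}" by auto
    have "\<bar>\<phi> j z - \<phi> j z'\<bar> \<le> L * \<bar>z - z'\<bar>"
      using lipschitz_onD[OF \<phi>_lipschitz[OF j], of z z'] by (simp add: dist_real_def)
    then show "\<bar>a j l x * (\<phi> j z - \<phi> j z')\<bar> \<le> C * (L * \<bar>z - z'\<bar>)"
      using a_bound[OF j l] C_nonneg by (auto simp: abs_mult intro!: mult_mono)
  qed
  also have "\<dots> = real (card (?J z \<union> ?J z')) * (C * (L * \<bar>z - z'\<bar>))"
    by simp
  also have "\<dots> \<le> 4 * (C * (L * \<bar>z - z'\<bar>))"
    using \<phi>_card[of z] \<phi>_card[of z'] card_Un_le[of "?J z" "?J z'"] C_nonneg L_nonneg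
    by (intro mult_right_mono) auto
  finally show ?thesis
    by (simp add: algebra_simps)
qed

lemma V_diff_le:
  assumes \<omega>: "\<omega> \<in> space P"
    and u: "\<And>x. \<bar>u (next_grid t) x\<bar> \<le> M" and w: "\<And>x. \<bar>w (next_grid t) x\<bar> \<le> M"
  defines "s \<equiv> next_grid t - t"
  shows "\<bar>V t x u u' \<omega> - V t x w w' \<omega>\<bar> \<le> majorant_at s \<omega> *
    ((\<Sum>k\<in>alive_at s \<omega>. \<bar>u (next_grid t) (position x k s \<omega>) - w (next_grid t) (position x k s \<omega>)\<bar> / M) +
     (\<Sum>k\<in>dead_at s \<omega>. 2 * L * \<bar>u' (t + death_at k \<omega>) (position x k (death_at k \<omega>) \<omega>) -
        w' (t + death_at k \<omega>) (position x k (death_at k \<omega>) \<omega>)\<bar>))"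
proof -
  let ?A = "alive_at s \<omega>" and ?D = "dead_at s \<omega>"
  let ?F = "\<lambda>k. tail_integral \<rho> (s - death_at (butlast k) \<omega>)"
  let ?q = "\<lambda>k. p (\<xi> k \<omega>) * \<rho> (\<delta> k \<omega>)"
  define factor where "factor v v' k = (if k \<in> ?A then v (next_grid t) (position x k s \<omega>) / ?F k
    else driver (\<xi> k \<omega>) (position x k (death_at k \<omega>) \<omega>)
      (v' (t + death_at k \<omega>) (position x k (death_at k \<omega>) \<omega>)) / ?q k)"
    for v v' :: "real \<Rightarrow> real^'d \<Rightarrow> real" and k
  define c where "c k = (if k \<in> ?A then M / ?F k else 2 * C / ?q k)" for k
  define d where "d k = (if k \<in> ?A
    then \<bar>u (next_grid t) (position x k s \<omega>) - w (next_grid t) (position x k s \<omega>)\<bar> / M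
    else 2 * L * \<bar>u' (t + death_at k \<omega>) (position x k (death_at k \<omega>) \<omega>) -
        w' (t + death_at k \<omega>) (position x k (death_at k \<omega>) \<omega>)\<bar>)" for k
  have F: "0 \<le> ?F k" if "k \<in> ?A" for k
    using parent_death_le[OF \<omega>, of k s] next_grid(1)[of t] that
    by (intro tail_integral_nonneg) (auto simp: in_alive_iff s_def)
  have q: "0 \<le> ?q k" and \<xi>: "\<xi> k \<omega> \<le> l0" if "k \<in> ?A \<union> ?D" for k
  proof -
    have "k \<in> K"
      using that alive_subset_labels[OF \<omega>] born_subset_labels[OF \<omega>] by auto
    then show "0 \<le> ?q k" "\<xi> k \<omega> \<le> l0"
      using \<xi>_le[OF _ \<omega>] \<delta>_nonneg[OF _ \<omega>] p_nonneg \<rho>_nonneg by auto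
  qed
  have bound: "\<bar>factor v v' k\<bar> \<le> c k"
    if k: "k \<in> ?A \<union> ?D" and v: "\<And>x. \<bar>v (next_grid t) x\<bar> \<le> M" for v v' k
  proof (cases "k \<in> ?A")
    case True
    then show ?thesis
      using F[OF True] v by (simp add: factor_def c_def abs_divide divide_right_mono)
  next
    case False
    have "\<bar>driver (\<xi> k \<omega>) x z\<bar> / ?q k \<le> 2 * C / ?q k" for x z
      by (intro divide_right_mono driver_bound \<xi>[OF k] q[OF k])
    with False show ?thesis
      using q[OF k] by (simp add: factor_def c_def abs_divide)
  qed
  have diff: "\<bar>factor u u' k - factor w w' k\<bar> \<le> d k * c k" if k: "k \<in> ?A \<union> ?D" for k
  proof (cases "k \<in> ?A")
    case True
    then have "factor u u' k - factor w w' k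
        = (u (next_grid t) (position x k s \<omega>) - w (next_grid t) (position x k s \<omega>)) / ?F k"
      by (simp add: factor_def diff_divide_distrib)
    with True show ?thesis
      using F[OF True] M_pos by (simp add: c_def d_def abs_divide)
  next
    case False
    let ?X = "position x k (death_at k \<omega>) \<omega>"
    have eq: "factor u u' k - factor w w' k = (driver (\<xi> k \<omega>) ?X (u' (t + death_at k \<omega>) ?X) -
        driver (\<xi> k \<omega>) ?X (w' (t + death_at k \<omega>) ?X)) / ?q k"
      using False by (simp add: factor_def diff_divide_distrib)
    have "\<bar>factor u u' k - factor w w' k\<bar>
        \<le> (2 * L * \<bar>u' (t + death_at k \<omega>) ?X - w' (t + death_at k \<omega>) ?X\<bar>) * (2 * C) / ?q k"
      unfolding eq abs_divide abs_of_nonneg[OF q[OF k]]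
      by (intro divide_right_mono driver_lipschitz \<xi>[OF k] q[OF k])
    also have "\<dots> = d k * c k"
      using False by (simp add: c_def d_def)
    finally show ?thesis .
  qed
  have V: "V t x v v' \<omega> = prod (factor v v') ?A * prod (factor v v') ?D" for v v'
    unfolding branch_op_def Let_def s_def[symmetric]
    by (intro arg_cong2[where f="(*)"] prod.cong) (simp_all add: factor_def)
  have "majorant_at s \<omega> = prod c ?A * prod c ?D"
    unfolding majorant_def
    by (intro arg_cong2[where f="(*)"] prod.cong) (simp_all add: c_def)
  moreover have "\<bar>V t x u u' \<omega> - V t x w w' \<omega>\<bar> \<le> (prod c ?A * prod c ?D) * (sum d ?A + sum d ?D)"
    unfolding V by (rule abs_prod_prod_diff_le) (use bound u w diff in auto)
  ultimately show ?thesis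
    by (simp add: d_def)
qed

lemma majorant_nonneg:
  assumes \<omega>: "\<omega> \<in> space P" and "0 \<le> s"
  shows "0 \<le> majorant_at s \<omega>"
  unfolding majorant_def
proof (intro mult_nonneg_nonneg prod_nonneg)
  fix k assume "k \<in> alive_at s \<omega>"
  then show "0 \<le> M / tail_integral \<rho> (s - death_at (butlast k) \<omega>)"
    using parent_death_le[OF \<omega>, of k s] \<open>0 \<le> s\<close> M_pos
    by (intro divide_nonneg_nonneg tail_integral_nonneg) (auto simp: in_alive_iff)
next
  fix k assume "k \<in> dead_at s \<omega>"
  then have "k \<in> K"
    using born_subset_labels[OF \<omega>] by auto
  then show "0 \<le> 2 * C / (p (\<xi> k \<omega>) * \<rho> (\<delta> k \<omega>))"
    using \<xi>_le[OF _ \<omega>] \<delta>_nonneg[OF _ \<omega>] p_nonneg \<rho>_nonneg C_nonneg by auto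
qed

text \<open>
  A particle that is dead at the next grid point died between \<open>t\<close> and that grid point, so that the
  second argument is only evaluated there.
\<close>

lemma V_cong:
  assumes \<omega>: "\<omega> \<in> space P"
    and eq: "\<And>s x. t \<le> s \<Longrightarrow> s \<le> next_grid t \<Longrightarrow> u' s x = w' s x"
  shows "V t x u u' \<omega> = V t x u w' \<omega>"
proof -
  have "u' (t + death_at k \<omega>) z = w' (t + death_at k \<omega>) z"
    if "k \<in> dead_at (next_grid t - t) \<omega>" for k z
    using that death_nonneg[OF born_subset_labels[OF \<omega>, of k "next_grid t - t"] \<omega>]
    by (intro eq) (auto simp: in_alive_iff)
  then show ?thesis
    unfolding branch_op_def Let_def
    by (intro arg_cong2[where f="(*)"] prod.cong arg_cong2[where f="(/)"] sum.cong) simp_all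
qed

definition EV :: "real \<Rightarrow> real^'d \<Rightarrow> (real \<Rightarrow> real^'d \<Rightarrow> real) \<Rightarrow> (real \<Rightarrow> real^'d \<Rightarrow> real) \<Rightarrow> real" where
  "EV t x u u' = (\<integral>\<omega>. V t x u u' \<omega> \<partial>P)"

lemma random_field_EV:
  assumes "random_field G u" "random_field G u'"
  shows "random_field G (\<lambda>\<omega> t x. EV t x (u \<omega>) (u' \<omega>))"
proof -
  have "(\<lambda>s. V (fst (fst (fst s))) (snd (fst (fst s))) (u (snd (fst s))) (u' (snd (fst s))) (snd s))
      \<in> borel_measurable ((borel \<Otimes>\<^sub>M G) \<Otimes>\<^sub>M P)"
    by (rule measurable_V[where \<pi>'="\<lambda>s. snd (fst s)" and G=G])
      (auto intro!: assms measurable_compose[OF measurable_fst measurable_time_space(1)]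
        measurable_compose[OF measurable_fst measurable_time_space(2)])
  then show ?thesis
    unfolding EV_def
    by (intro random_fieldI borel_measurable_lebesgue_integral) (simp add: case_prod_beta')
qed

definition M1 :: ennreal where
  "M1 = (SUP t\<in>{0..h}. \<integral>\<^sup>+\<omega>. of_nat (card (alive_at t \<omega>)) * ennreal (majorant_at t \<omega>) \<partial>P)"

definition M2 :: ennreal where
  "M2 = (SUP t\<in>{0..h}. \<integral>\<^sup>+\<omega>. of_nat (card (born_at t \<omega>)) * ennreal (majorant_at t \<omega>) \<partial>P)"

text \<open>
  The arguments depend on \<open>\<omega>\<close> and the particles on an independent copy \<open>\<omega>'\<close>. For fixed \<open>\<omega>'\<close> the particles
  sit at fixed points of space-time, where the mean error is at most \<open>e\<close> or \<open>e'\<close>; what remains is the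
  number of particles times the majorant, integrated over \<open>\<omega>'\<close>.
\<close>

lemma EV_diff_le:
  assumes u: "random_field P u" "random_field P u'" and w: "random_field P w" "random_field P w'"
    and uM: "\<And>\<omega> x. \<omega> \<in> space P \<Longrightarrow> \<bar>u \<omega> (next_grid t) x\<bar> \<le> M"
    and wM: "\<And>\<omega> x. \<omega> \<in> space P \<Longrightarrow> \<bar>w \<omega> (next_grid t) x\<bar> \<le> M"
    and e: "\<And>x. (\<integral>\<^sup>+\<omega>. ennreal \<bar>u \<omega> (next_grid t) x - w \<omega> (next_grid t) x\<bar> \<partial>P) \<le> e"
    and e': "\<And>s x. t \<le> s \<Longrightarrow> s \<le> next_grid t \<Longrightarrow>
        (\<integral>\<^sup>+\<omega>. ennreal \<bar>u' \<omega> s x - w' \<omega> s x\<bar> \<partial>P) \<le> e'"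
  shows "(\<integral>\<^sup>+\<omega>. ennreal \<bar>EV t x (u \<omega>) (u' \<omega>) - EV t x (w \<omega>) (w' \<omega>)\<bar> \<partial>P)
    \<le> M1 / ennreal M * e + 2 * ennreal L * M2 * e'"
proof -
  interpret PP: pair_sigma_finite P P ..
  define r where "r = next_grid t"
  define s where "s = r - t"
  have s: "0 < s" "s \<le> h" "s \<le> T"
    using next_grid[of t] h_le by (auto simp: s_def r_def)
  have card_dead: "of_nat (card (dead_at s \<omega>)) \<le> (of_nat (card (born_at s \<omega>)) :: ennreal)"
    if "\<omega> \<in> space P" for \<omega>
    using finite_born[OF that, of s] by (cases "finite (dead_at s \<omega>)") (auto intro!: card_mono)
  define X where "X k \<omega> = position x k s \<omega>" for k \<omega>
  \<comment> \<open>The time of death is clipped at \<open>T\<close> to stay in the domain of \<open>\<Phi>\<close>; the particles of interest died before \<open>s \<le> T\<close>.\<close>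
  define X' where "X' k \<omega> = position x k (min (death_at k \<omega>) T) \<omega>" for k \<omega>
  have X: "X k \<in> borel_measurable P" if "k \<in> K" for k
    unfolding X_def using s by (intro measurable_position that) auto
  have X': "X' k \<in> borel_measurable P" if "k \<in> K" for k
    unfolding X'_def using measurable_death[OF that] death_nonneg[OF that] h_pos h_le
    by (intro measurable_position that) auto
  define a where "a k z = ennreal (\<bar>u (fst z) r (X k (snd z)) - w (fst z) r (X k (snd z))\<bar> / M)" for k z
  define b where "b k z = ennreal (2 * L * \<bar>u' (fst z) (t + death_at k (snd z)) (X' k (snd z)) -
      w' (fst z) (t + death_at k (snd z)) (X' k (snd z))\<bar>)" for k z
  have a: "a k \<in> borel_measurable (P \<Otimes>\<^sub>M P)" if k: "k \<in> K" for k
  proof -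
    note X[OF k, measurable]
    have [measurable]: "(\<lambda>z. v (fst z) r (X k (snd z))) \<in> borel_measurable (P \<Otimes>\<^sub>M P)"
      if "random_field P v" for v
      by (intro random_field_compose[OF that]) measurable
    note this[OF u(1), measurable] this[OF w(1), measurable]
    show ?thesis
      unfolding a_def by measurable
  qed
  have b: "b k \<in> borel_measurable (P \<Otimes>\<^sub>M P)" if k: "k \<in> K" for k
  proof -
    note X'[OF k, measurable] measurable_death[OF k, measurable]
    have [measurable]: "(\<lambda>z. v (fst z) (t + death_at k (snd z)) (X' k (snd z))) \<in> borel_measurable (P \<Otimes>\<^sub>M P)"
      if "random_field P v" for v
      by (intro random_field_compose[OF that]) measurable
    note this[OF u(2), measurable] this[OF w(2), measurable]
    show ?thesis
      unfolding b_def by measurable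
  qed
  have sum_a: "(\<lambda>z. \<Sum>k\<in>alive_at s (snd z). a k z) \<in> borel_measurable (P \<Otimes>\<^sub>M P)"
    by (rule measurable_random_set[where g="\<lambda>B z. \<Sum>k\<in>B. a k z" and K=K])
      (use a alive_subset_labels in \<open>auto intro!: pred_alive borel_measurable_sum simp: space_pair_measure\<close>)
  have sum_b: "(\<lambda>z. \<Sum>k\<in>dead_at s (snd z). b k z) \<in> borel_measurable (P \<Otimes>\<^sub>M P)"
    by (rule measurable_random_set[where g="\<lambda>B z. \<Sum>k\<in>B. b k z" and K=K])
      (use b born_subset_labels in \<open>auto intro!: pred_dead[unfolded Diff_iff] borel_measurable_sum simp: space_pair_measure\<close>)
  have maj [measurable]: "majorant_at s \<in> borel_measurable P"
    using s by (intro measurable_majorant) auto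
  define f where "f z = ennreal (majorant_at s (snd z)) *
      ((\<Sum>k\<in>alive_at s (snd z). a k z) + (\<Sum>k\<in>dead_at s (snd z). b k z))" for z
  have f: "f \<in> borel_measurable (P \<Otimes>\<^sub>M P)"
    unfolding f_def using sum_a sum_b by measurable
  have V_meas: "(\<lambda>\<omega>'. V t x (v \<omega>) (v' \<omega>) \<omega>') \<in> borel_measurable P"
    if "random_field P v" "random_field P v'" "\<omega> \<in> space P" for v v' \<omega>
    using that by (intro measurable_V[where \<pi>'="\<lambda>_. \<omega>" and G=P]) auto
  have "(\<integral>\<^sup>+\<omega>. ennreal \<bar>EV t x (u \<omega>) (u' \<omega>) - EV t x (w \<omega>) (w' \<omega>)\<bar> \<partial>P)
      \<le> (\<integral>\<^sup>+\<omega>. \<integral>\<^sup>+\<omega>'. ennreal \<bar>V t x (u \<omega>) (u' \<omega>) \<omega>' - V t x (w \<omega>) (w' \<omega>) \<omega>'\<bar> \<partial>P \<partial>P)"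
    unfolding EV_def by (intro nn_integral_mono abs_integral_diff_le_nn_integral V_meas u w)
  also have "\<dots> \<le> (\<integral>\<^sup>+\<omega>. \<integral>\<^sup>+\<omega>'. f (\<omega>, \<omega>') \<partial>P \<partial>P)"
  proof (intro nn_integral_mono)
    fix \<omega> \<omega>' assume \<omega>: "\<omega> \<in> space P" and \<omega>': "\<omega>' \<in> space P"
    have "X' k \<omega>' = position x k (death_at k \<omega>') \<omega>'" if "k \<in> dead_at s \<omega>'" for k
      using that s by (auto simp: X'_def in_alive_iff)
    then have "\<bar>V t x (u \<omega>) (u' \<omega>) \<omega>' - V t x (w \<omega>) (w' \<omega>) \<omega>'\<bar> \<le> majorant_at s \<omega>' *
      ((\<Sum>k\<in>alive_at s \<omega>'. \<bar>u \<omega> r (X k \<omega>') - w \<omega> r (X k \<omega>')\<bar> / M) +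
       (\<Sum>k\<in>dead_at s \<omega>'. 2 * L * \<bar>u' \<omega> (t + death_at k \<omega>') (X' k \<omega>') -
        w' \<omega> (t + death_at k \<omega>') (X' k \<omega>')\<bar>))"
      using V_diff_le[OF \<omega>', of "u \<omega>" t "w \<omega>" x "u' \<omega>" "w' \<omega>"] uM[OF \<omega>] wM[OF \<omega>]
      by (simp add: X_def r_def s_def)
    then have "ennreal \<bar>V t x (u \<omega>) (u' \<omega>) \<omega>' - V t x (w \<omega>) (w' \<omega>) \<omega>'\<bar> \<le> ennreal (majorant_at s \<omega>' *
      ((\<Sum>k\<in>alive_at s \<omega>'. \<bar>u \<omega> r (X k \<omega>') - w \<omega> r (X k \<omega>')\<bar> / M) +
       (\<Sum>k\<in>dead_at s \<omega>'. 2 * L * \<bar>u' \<omega> (t + death_at k \<omega>') (X' k \<omega>') -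
        w' \<omega> (t + death_at k \<omega>') (X' k \<omega>')\<bar>)))"
      by (rule ennreal_leI)
    also have "\<dots> = f (\<omega>, \<omega>')"
      using majorant_nonneg[OF \<omega>', of s] s M_pos L_nonneg
      by (subst ennreal_mult', simp, subst ennreal_plus)
        (simp_all add: f_def a_def b_def sum_nonneg sum_ennreal del: ennreal_plus)
    finally show "ennreal \<bar>V t x (u \<omega>) (u' \<omega>) \<omega>' - V t x (w \<omega>) (w' \<omega>) \<omega>'\<bar> \<le> f (\<omega>, \<omega>')" .
  qed
  also have "\<dots> = (\<integral>\<^sup>+\<omega>'. \<integral>\<^sup>+\<omega>. f (\<omega>, \<omega>') \<partial>P \<partial>P)"
    using PP.Fubini'[of "\<lambda>\<omega> \<omega>'. f (\<omega>, \<omega>')"] f by simp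
  also have "\<dots> \<le> (\<integral>\<^sup>+\<omega>'. e / ennreal M * (of_nat (card (alive_at s \<omega>')) * ennreal (majorant_at s \<omega>')) +
      2 * ennreal L * e' * (of_nat (card (born_at s \<omega>')) * ennreal (majorant_at s \<omega>')) \<partial>P)"
  proof (rule nn_integral_mono)
    fix \<omega>' assume \<omega>': "\<omega>' \<in> space P"
    have am: "(\<lambda>\<omega>. a k (\<omega>, \<omega>')) \<in> borel_measurable P" if "k \<in> alive_at s \<omega>'" for k
      using measurable_compose[OF measurable_Pair2'[OF \<omega>'] a[OF alive_subset_labels[OF \<omega>' that]]] by simp
    have bm: "(\<lambda>\<omega>. b k (\<omega>, \<omega>')) \<in> borel_measurable P" if "k \<in> dead_at s \<omega>'" for k
      using measurable_compose[OF measurable_Pair2'[OF \<omega>'] b[OF born_subset_labels[OF \<omega>', of k s]]] that by simp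
    have "(\<integral>\<^sup>+\<omega>. f (\<omega>, \<omega>') \<partial>P) = ennreal (majorant_at s \<omega>') *
        ((\<Sum>k\<in>alive_at s \<omega>'. \<integral>\<^sup>+\<omega>. a k (\<omega>, \<omega>') \<partial>P) + (\<Sum>k\<in>dead_at s \<omega>'. \<integral>\<^sup>+\<omega>. b k (\<omega>, \<omega>') \<partial>P))"
      using am bm by (simp add: f_def nn_integral_cmult nn_integral_add
          nn_integral_sum[OF am] nn_integral_sum[OF bm] del: Diff_iff)
    also have "\<dots> \<le> ennreal (majorant_at s \<omega>') *
        (of_nat (card (alive_at s \<omega>')) * (e / ennreal M) + of_nat (card (dead_at s \<omega>')) * (2 * ennreal L * e'))"
    proof (intro mult_left_mono add_mono sum_bounded_above)
      fix k assume k: "k \<in> alive_at s \<omega>'"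
      have meas: "(\<lambda>\<omega>. v \<omega> r (X k \<omega>')) \<in> borel_measurable P" if "random_field P v" for v
        by (intro random_field_compose[OF that]) auto
      have "(\<integral>\<^sup>+\<omega>. a k (\<omega>, \<omega>') \<partial>P) = (\<integral>\<^sup>+\<omega>. ennreal \<bar>u \<omega> r (X k \<omega>') - w \<omega> r (X k \<omega>')\<bar> / ennreal M \<partial>P)"
        using M_pos by (simp add: a_def divide_ennreal)
      also have "\<dots> = (\<integral>\<^sup>+\<omega>. ennreal \<bar>u \<omega> r (X k \<omega>') - w \<omega> r (X k \<omega>')\<bar> \<partial>P) / ennreal M"
        using meas[OF u(1)] meas[OF w(1)] by (intro nn_integral_divide) measurable
      also have "\<dots> \<le> e / ennreal M"
        using e[of "X k \<omega>'"] by (intro divide_right_mono_ennreal) (simp add: r_def)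
      finally show "(\<integral>\<^sup>+\<omega>. a k (\<omega>, \<omega>') \<partial>P) \<le> e / ennreal M" .
    next
      fix k assume k: "k \<in> dead_at s \<omega>'"
      then have "0 \<le> death_at k \<omega>'" "death_at k \<omega>' \<le> s"
        using death_nonneg[OF born_subset_labels[OF \<omega>', of k s] \<omega>'] by (auto simp: in_alive_iff)
      then have le: "t \<le> t + death_at k \<omega>'" "t + death_at k \<omega>' \<le> next_grid t"
        by (auto simp: s_def r_def)
      have meas: "(\<lambda>\<omega>. v \<omega> (t + death_at k \<omega>') (X' k \<omega>')) \<in> borel_measurable P" if "random_field P v" for v
        by (intro random_field_compose[OF that]) auto
      have "(\<integral>\<^sup>+\<omega>. b k (\<omega>, \<omega>') \<partial>P) = (\<integral>\<^sup>+\<omega>. (2 * ennreal L) *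
          ennreal \<bar>u' \<omega> (t + death_at k \<omega>') (X' k \<omega>') - w' \<omega> (t + death_at k \<omega>') (X' k \<omega>')\<bar> \<partial>P)"
        using L_nonneg by (simp add: b_def ennreal_mult)
      also have "\<dots> = (2 * ennreal L) * (\<integral>\<^sup>+\<omega>.
          ennreal \<bar>u' \<omega> (t + death_at k \<omega>') (X' k \<omega>') - w' \<omega> (t + death_at k \<omega>') (X' k \<omega>')\<bar> \<partial>P)"
        using meas[OF u(2)] meas[OF w(2)] by (intro nn_integral_cmult) measurable
      also have "\<dots> \<le> 2 * ennreal L * e'"
        using e'[OF le] by (intro mult_left_mono) auto
      finally show "(\<integral>\<^sup>+\<omega>. b k (\<omega>, \<omega>') \<partial>P) \<le> 2 * ennreal L * e'" .
    qed simp
    also have "\<dots> \<le> ennreal (majorant_at s \<omega>') *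
        (of_nat (card (alive_at s \<omega>')) * (e / ennreal M) + of_nat (card (born_at s \<omega>')) * (2 * ennreal L * e'))"
      using card_dead[OF \<omega>'] by (intro mult_left_mono add_mono mult_right_mono) auto
    finally show "(\<integral>\<^sup>+\<omega>. f (\<omega>, \<omega>') \<partial>P) \<le> e / ennreal M * (of_nat (card (alive_at s \<omega>')) * ennreal (majorant_at s \<omega>')) +
      2 * ennreal L * e' * (of_nat (card (born_at s \<omega>')) * ennreal (majorant_at s \<omega>'))"
      by (simp add: distrib_left mult_ac)
  qed
  also have "\<dots> = e / ennreal M * (\<integral>\<^sup>+\<omega>'. of_nat (card (alive_at s \<omega>')) * ennreal (majorant_at s \<omega>') \<partial>P) +
      2 * ennreal L * e' * (\<integral>\<^sup>+\<omega>'. of_nat (card (born_at s \<omega>')) * ennreal (majorant_at s \<omega>') \<partial>P)"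
    using measurable_card_alive[of s] measurable_card_born[of s]
    by (simp add: nn_integral_add nn_integral_cmult)
  also have "\<dots> \<le> e / ennreal M * M1 + 2 * ennreal L * e' * M2"
    using s unfolding M1_def M2_def
    by (intro add_mono mult_left_mono SUP_upper) auto
  finally show ?thesis
    by (simp add: mult_ac divide_ennreal_def)
qed

end

section \<open>The recursion in the iteration index and the time index\<close>

text \<open>
  Since \<open>1 \<le> c\<close>, adding \<open>err\<close> to both sides turns the recursion into
  \<open>F m n \<le> c * F m (n - 1) + c * F (m - 1) n\<close> for \<open>F m n = err + D m n\<close>, which Pascal's rule solves.
  The values may be infinite, and \<open>err = 0\<close> still forces \<open>D = 0\<close>.
\<close>

lemma two_index_recursion_le:
  fixes D :: "nat \<Rightarrow> nat \<Rightarrow> ennreal"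
  assumes zero: "\<And>n. D 0 n = 0" "\<And>m. D m 0 = 0"
    and step: "\<And>m n. n < N \<Longrightarrow> D (Suc m) (Suc n) \<le> max (D (Suc m) n) (err + A * D (Suc m) n + B * D m (Suc n))"
    and c: "A \<le> c" "B \<le> c" "1 \<le> c"
    and n: "n \<le> N"
  shows "err + D m n \<le> err * of_nat ((m + n) choose n) * c ^ (m + n)"
  using n
proof (induction "m + n" arbitrary: m n)
  case 0
  then show ?case by (simp add: zero)
next
  case (Suc k)
  have one: "1 \<le> c ^ j" for j
    using c(3) by (simp add: one_le_power)
  show ?case
  proof (cases "m = 0 \<or> n = 0")
    case True
    then show ?thesis
      using mult_left_mono[OF one[of "m + n"], of err] by (auto simp: zero)
  next
    case False
    then obtain m' n' where mn: "m = Suc m'" "n = Suc n'"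
      by (auto simp: gr0_conv_Suc)
    have k: "m + n' = k" "m' + n = k" "m + n = Suc k" and n': "n' < N"
      using Suc mn by auto
    have 1: "err + D m n' \<le> err * of_nat (k choose n') * c ^ k"
      using Suc.hyps(1)[of m n'] k n' by simp
    have 2: "err + D m' n \<le> err * of_nat (k choose n) * c ^ k"
      using Suc.hyps(1)[of m' n] k Suc.prems by simp
    have "err + D m n \<le> c * (err + D m n') + c * (err + D m' n)"
    proof -
      have e: "err \<le> c * err" and d: "D m n' \<le> c * D m n'"
        using mult_right_mono[OF c(3)] by (simp_all only: mult_1_left zero_le)
      have "D m n \<le> max (D m n') (err + A * D m n' + B * D m' n)"
        using step[OF n', of m'] mn by simp
      also have "\<dots> \<le> c * err + c * D m n' + c * D m' n"
        using c(1,2) e d by (intro max.boundedI add_mono mult_right_mono)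
          (auto intro: order_trans[OF d] simp: add_increasing add_increasing2)
      finally have "err + D m n \<le> c * err + (c * err + c * D m n' + c * D m' n)"
        using e by (rule add_mono[rotated])
      then show ?thesis
        by (simp add: distrib_left add_ac)
    qed
    also have "\<dots> \<le> c * (err * of_nat (k choose n') * c ^ k) + c * (err * of_nat (k choose n) * c ^ k)"
      using 1 2 by (intro add_mono mult_left_mono) auto
    also have "\<dots> = err * of_nat (Suc k choose n) * c ^ Suc k"
      by (simp add: mn distrib_left distrib_right mult_ac)
    finally show ?thesis
      by (simp only: k)
  qed
qed

lemma binomial_le_scheme_constant:
  "ennreal (real ((m + N) choose N)) \<le> ennreal ((1 + real N) * ((real m + real N) ^ N / fact N))"
proof (rule ennreal_leI)
  have "real ((m + N) choose N) * fact N \<le> (real m + real N) ^ N"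
    using of_nat_mono[OF binomial_fact_pow[of "m + N" N], where 'a=real] by simp
  then have "real ((m + N) choose N) \<le> (real m + real N) ^ N / fact N"
    by (simp add: field_simps)
  also have "\<dots> \<le> (1 + real N) * ((real m + real N) ^ N / fact N)"
    using mult_right_mono[of 1 "1 + real N" "(real m + real N) ^ N / fact N"] by simp
  finally show "real ((m + N) choose N) \<le> (1 + real N) * ((real m + real N) ^ N / fact N)" .
qed

lemma borel_measurable_clamp_real: "clamp_real c \<in> borel_measurable borel"
  unfolding clamp_real_def by measurable

lemma abs_clamp_real: "0 \<le> c \<Longrightarrow> \<bar>clamp_real c z\<bar> \<le> c"
  by (auto simp: clamp_real_def)

lemma clamp_real_eq: "\<bar>z\<bar> \<le> c \<Longrightarrow> clamp_real c z = z"
  by (auto simp: clamp_real_def)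

lemma clamp_real_lipschitz: "\<bar>clamp_real c z - clamp_real c z'\<bar> \<le> \<bar>z - z'\<bar>"
  by (auto simp: clamp_real_def max_def min_def)

section \<open>Error of the scheme\<close>

context branching_diffusion
begin

lemma scheme_error_le:
  fixes v :: "nat \<Rightarrow> real \<Rightarrow> real^'d \<Rightarrow> real" and vhat :: "nat \<Rightarrow> 'w \<Rightarrow> real \<Rightarrow> real^'d \<Rightarrow> real"
  assumes T: "real N * h = T"
    and G: "sets G \<subseteq> sets P" "space G = space P"
    and L0: "L0 \<subseteq> Linf T B"
    and A_range: "\<And>u u' \<omega>. u \<in> L0 \<Longrightarrow> u' \<in> L0 \<Longrightarrow> \<omega> \<in> space P \<Longrightarrow> A u u' \<omega> \<in> L0"
    and A_meas: "\<And>u u'. u \<in> random_elements P G L0 \<Longrightarrow> u' \<in> random_elements P G L0 \<Longrightarrow>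
      random_field G (\<lambda>\<omega>. A (u \<omega>) (u' \<omega>) \<omega>)"
    and g: "g \<in> borel_measurable borel" "\<And>x. \<bar>g x\<bar> \<le> M"
    and v: "exact_iterates T h N M g y EV v"
    and vhat: "numerical_iterates P T h N M B L0 g y A vhat"
  defines "err \<equiv> operator_error P G T L0 EV A"
    and "c \<equiv> max (max (2 * ennreal L * M2) (M1 / ennreal M)) 1"
  shows "(SUP (t, x)\<in>{0..T} \<times> UNIV. \<integral>\<^sup>+\<omega>. ennreal \<bar>v m t x - vhat m \<omega> t x\<bar> \<partial>P)
     \<le> err * of_nat ((m + N) choose N) * c ^ (m + N)"
proof -
  let ?r = "\<lambda>i. real (Suc i) * h"
  have r_le: "?r i \<le> T" and r_pos: "0 < ?r i" and i_nonneg: "0 \<le> real i * h" if "i < N" for i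
  proof -
    show "?r i \<le> T"
      unfolding T[symmetric] using that h_pos by (intro mult_right_mono) auto
    show "0 < ?r i" "0 \<le> real i * h"
      using h_pos by auto
  qed
  have T_pos: "0 < T"
    using h_pos h_le by simp
  have v0: "v 0 = y" and vT: "v (Suc m) T x = g x" for m x
    using v by (auto simp: exact_iterates_def)
  have v_grid: "v (Suc m) (real i * h) x =
        clamp_real M (EV (real i * h) x (frozen T (v (Suc m)) (?r i)) (v m))" if "i < N" for m i x
    using v that by (auto simp: exact_iterates_def)
  have v_inner: "v (Suc m) t x = EV t x (frozen T (v (Suc m)) (?r i)) (v m)"
    if "i < N" "t \<in> {real i * h <..< ?r i}" for m i t x
    using v that unfolding exact_iterates_def by (metis diff_Suc_1 le_add1 plus_1_eq_Suc)
  have vhat0: "vhat 0 \<omega> = y" and vhat_L0: "vhat m \<omega> \<in> L0" and vhatT: "vhat (Suc m) \<omega> T x = g x"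
    if "\<omega> \<in> space P" for m \<omega> x
    using vhat that by (auto simp: numerical_iterates_def)
  have frozen_L0: "frozen T (vhat (Suc m) \<omega>) (?r i) \<in> L0" if "i < N" "\<omega> \<in> space P" for m i \<omega>
    using vhat that unfolding numerical_iterates_def by (metis le_add1 plus_1_eq_Suc)
  have vhat_grid: "vhat (Suc m) \<omega> (real i * h) x =
        clamp_real M (A (frozen T (vhat (Suc m) \<omega>) (?r i)) (vhat m \<omega>) \<omega> (real i * h) x)"
    if "i < N" "\<omega> \<in> space P" for m i \<omega> x
    using vhat that by (auto simp: numerical_iterates_def)
  have vhat_inner: "vhat (Suc m) \<omega> t x =
        clamp_real B (A (frozen T (vhat (Suc m) \<omega>) (?r i)) (vhat m \<omega>) \<omega> t x)"
    if "i < N" "\<omega> \<in> space P" "t \<in> {real i * h <..< ?r i}" for m i \<omega> t x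
    using vhat that unfolding numerical_iterates_def by (metis diff_Suc_1 le_add1 plus_1_eq_Suc)
  have L0_zero: "u t x = 0" if "u \<in> L0" "t \<notin> {0..T}" for u t x
    using that L0 by (auto simp: Linf_def)
  have L0_bound: "\<bar>u t x\<bar> \<le> B" if "u \<in> L0" "t \<in> {0..T}" for u t x
    using that L0 by (auto simp: Linf_def)
  have y: "random_field Q (\<lambda>_. y)" for Q :: "'w measure"
  proof -
    obtain \<omega> where \<omega>: "\<omega> \<in> space P"
      using not_empty by auto
    have "(\<lambda>(t, x). y t x) \<in> borel_measurable borel"
      using vhat_L0[OF \<omega>, of 0] vhat0[OF \<omega>] L0 by (auto simp: Linf_def)
    from measurable_compose[OF measurable_fst this] show ?thesis
      by (simp add: random_field_def case_prod_beta')
  qed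
  have vhat_G: "random_field G (vhat m)" for m
  proof (induction m)
    case 0
    then show ?case
      using y[of G] by (subst random_field_cong) (auto simp: vhat0 G)
  next
    case (Suc m)
    have "random_field G (\<lambda>\<omega> t x. if t \<in> {0..T} then vhat (Suc m) \<omega> t x else 0)"
    proof (rule random_field_scheme[OF h_pos T g(1) borel_measurable_clamp_real borel_measurable_clamp_real])
      fix i assume i: "i < N" and "random_field G (\<lambda>\<omega>. frozen T (vhat (Suc m) \<omega>) (?r i))"
      then show "random_field G (\<lambda>\<omega>. A (frozen T (vhat (Suc m) \<omega>) (?r i)) (vhat m \<omega>) \<omega>)"
        using Suc frozen_L0[OF i] vhat_L0
        by (intro A_meas) (auto simp: random_elements_def random_field_def)
    qed (use vhatT vhat_grid vhat_inner G in auto)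
    then show ?case
      by (subst random_field_cong) (use vhat_L0 L0_zero G in auto)
  qed
  have vhat_P: "random_field P (vhat m)" for m
    by (rule random_field_coarser[OF G vhat_G])
  define v' where "v' m t x = (if t \<in> {0..T} then v m t x else 0)" for m t x
  have frozen_v': "frozen T (v' m) (?r i) = frozen T (v m) (?r i)" if "i < N" for m i
    using r_le[OF that] r_pos[OF that] by (auto simp: frozen_def v'_def fun_eq_iff)
  have next_grid_eq: "next_grid t = ?r i" if "t \<in> {real i * h..<?r i}" for i t
  proof -
    have "\<lfloor>t / h\<rfloor> = int i"
      using that h_pos by (intro floor_unique) (auto simp: field_simps)
    then show ?thesis by (simp add: add_ac)
  qed
  \<comment> \<open>The exact iterates are unspecified outside \<open>[0, T]\<close>; setting them to 0 there does not change \<open>EV\<close>.\<close>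
  have EV_v': "EV t x u (v m) = EV t x u (v' m)" if "i < N" "t \<in> {real i * h..<?r i}" for i t x u m
    unfolding EV_def
  proof (intro Bochner_Integration.integral_cong refl V_cong)
    fix s z assume "t \<le> s" "s \<le> next_grid t"
    then have "0 \<le> s" "s \<le> T"
      using next_grid_eq[OF that(2)] that r_le[OF that(1)] i_nonneg[OF that(1)] by auto
    then show "v m s z = v' m s z"
      by (simp add: v'_def)
  qed
  have v'_P: "random_field P (\<lambda>_. v' m)" for m
  proof (induction m)
    case 0
    have "v' 0 = y"
    proof (intro ext)
      fix t x
      obtain \<omega> where \<omega>: "\<omega> \<in> space P"
        using not_empty by auto
      show "v' 0 t x = y t x"
        using L0_zero[OF vhat_L0[OF \<omega>, of 0], of t x] vhat0[OF \<omega>] by (auto simp: v'_def v0)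
    qed
    then show ?case
      using y[of P] by simp
  next
    case (Suc m)
    have "random_field P (\<lambda>\<omega> t x. if t \<in> {0..T} then v (Suc m) t x else 0)"
    proof (rule random_field_scheme[OF h_pos T g(1) borel_measurable_clamp_real measurable_ident, where R="\<lambda>i _ t x. EV t x (frozen T (v (Suc m)) (?r i)) (v' m)"])
      fix i assume "random_field P (\<lambda>_. frozen T (v (Suc m)) (?r i))"
      from random_field_EV[OF this Suc]
      show "random_field P (\<lambda>_ t x. EV t x (frozen T (v (Suc m)) (?r i)) (v' m))" .
    next
      fix i x assume i: "i < N"
      show "v (Suc m) (real i * h) x = clamp_real M (EV (real i * h) x (frozen T (v (Suc m)) (?r i)) (v' m))"
        using v_grid[OF i] EV_v'[OF i, of "real i * h"] h_pos by simp
    next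
      fix i t x assume i: "i < N" and t: "t \<in> {real i * h <..< ?r i}"
      show "v (Suc m) t x = id (EV t x (frozen T (v (Suc m)) (?r i)) (v' m))"
        using v_inner[OF i t] EV_v'[OF i, of t] t by simp
    qed (simp add: vT)
    then show ?case
      by (simp add: v'_def[abs_def])
  qed
  have at_grid: "\<bar>v (Suc m) (?r i) x\<bar> \<le> M" "\<omega> \<in> space P \<Longrightarrow> \<bar>vhat (Suc m) \<omega> (?r i) x\<bar> \<le> M"
    if i: "i < N" for m i x \<omega>
  proof -
    have "Suc i < N \<or> ?r i = T"
      using i T by (metis Suc_lessI)
    then show "\<bar>v (Suc m) (?r i) x\<bar> \<le> M" "\<omega> \<in> space P \<Longrightarrow> \<bar>vhat (Suc m) \<omega> (?r i) x\<bar> \<le> M"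
      using v_grid[of "Suc i"] vhat_grid[of "Suc i"] vT vhatT g(2) abs_clamp_real[of M] M_pos
      by (auto simp del: of_nat_Suc)
  qed
  define E where "E m t x = (\<integral>\<^sup>+\<omega>. ennreal \<bar>v m t x - vhat m \<omega> t x\<bar> \<partial>P)" for m t x
  have local_error: "E (Suc m) t x \<le> err + M1 / ennreal M * e + 2 * ennreal L * M2 * e'"
    if i: "i < N" and t: "t \<in> {real i * h..<?r i}"
      and e: "\<And>z. E (Suc m) (?r i) z \<le> e" and e': "\<And>s z. t \<le> s \<Longrightarrow> s \<le> ?r i \<Longrightarrow> E m s z \<le> e'"
    for m i t x e e'
  proof -
    let ?u = "frozen T (v (Suc m)) (?r i)" and ?w = "\<lambda>\<omega>. frozen T (vhat (Suc m) \<omega>) (?r i)"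
    have fields: "random_field P (\<lambda>_. ?u)" "random_field P (\<lambda>_. v' m)" "random_field P ?w" "random_field P (vhat m)"
      using random_field_frozen[OF v'_P[of "Suc m"], of T "?r i"] random_field_frozen[OF vhat_P[of "Suc m"], of T "?r i"]
        v'_P[of m] vhat_P[of m] by (simp_all only: frozen_v'[OF i])
    have elements: "?w \<in> random_elements P G L0" "vhat m \<in> random_elements P G L0"
      using frozen_L0[OF i] vhat_L0 random_field_frozen[OF vhat_G[of "Suc m"], of T "?r i"] vhat_G[of m]
      by (simp_all add: random_elements_def random_field_def)
    have t': "0 \<le> t" "t < T"
      using t r_le[OF i] i_nonneg[OF i] by auto
    have r: "?r i \<in> {0..T}"
      using r_le[OF i] r_pos[OF i] by simp
    define Au where "Au \<omega> = A (?w \<omega>) (vhat m \<omega>) \<omega> t x" for \<omega>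
    \<comment> \<open>The values of the operator lie in \<open>L0\<close>, hence its truncation at \<open>B\<close> has no effect.\<close>
    have Au_bound: "\<bar>Au \<omega>\<bar> \<le> B" if "\<omega> \<in> space P" for \<omega>
      unfolding Au_def using L0_bound[OF A_range[OF frozen_L0[OF i that] vhat_L0[OF that] that]] t' by auto
    \<comment> \<open>At the grid point both schemes are truncated at \<open>M\<close>; after it neither is changed by truncation.\<close>
    have le: "\<bar>v (Suc m) t x - vhat (Suc m) \<omega> t x\<bar> \<le> \<bar>EV t x ?u (v' m) - Au \<omega>\<bar>" if \<omega>: "\<omega> \<in> space P" for \<omega>
    proof (cases "t = real i * h")
      case True
      then show ?thesis
        using clamp_real_lipschitz[of M "EV t x ?u (v' m)" "Au \<omega>"] v_grid[OF i] EV_v'[OF i t] vhat_grid[OF i \<omega>]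
        by (simp add: Au_def)
    next
      case False
      then have t: "t \<in> {real i * h <..< ?r i}"
        using t by auto
      then show ?thesis
        using v_inner[OF i t] EV_v'[OF i, of t] vhat_inner[OF i \<omega> t] clamp_real_eq[OF Au_bound[OF \<omega>]]
        by (simp add: Au_def)
    qed
    have [measurable]: "(\<lambda>\<omega>. EV t x (?w \<omega>) (vhat m \<omega>)) \<in> borel_measurable P"
      by (rule random_field_compose[OF random_field_EV[OF fields(3,4)], where \<tau>="\<lambda>_. t" and \<zeta>="\<lambda>_. x"]) auto
    have [measurable]: "Au \<in> borel_measurable P"
      unfolding Au_def
      by (rule random_field_compose[OF random_field_coarser[OF G A_meas[OF elements]], where \<tau>="\<lambda>_. t" and \<zeta>="\<lambda>_. x"]) auto
    have "E (Suc m) t x \<le> (\<integral>\<^sup>+\<omega>. ennreal \<bar>EV t x ?u (v' m) - EV t x (?w \<omega>) (vhat m \<omega>)\<bar> +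
        ennreal \<bar>EV t x (?w \<omega>) (vhat m \<omega>) - Au \<omega>\<bar> \<partial>P)"
      unfolding E_def
    proof (rule nn_integral_mono)
      fix \<omega> assume "\<omega> \<in> space P"
      from le[OF this] show "ennreal \<bar>v (Suc m) t x - vhat (Suc m) \<omega> t x\<bar> \<le>
          ennreal \<bar>EV t x ?u (v' m) - EV t x (?w \<omega>) (vhat m \<omega>)\<bar> + ennreal \<bar>EV t x (?w \<omega>) (vhat m \<omega>) - Au \<omega>\<bar>"
        by (subst ennreal_plus[symmetric]) (auto intro!: ennreal_leI simp del: ennreal_plus)
    qed
    also have "\<dots> = (\<integral>\<^sup>+\<omega>. ennreal \<bar>EV t x ?u (v' m) - EV t x (?w \<omega>) (vhat m \<omega>)\<bar> \<partial>P) +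
        (\<integral>\<^sup>+\<omega>. ennreal \<bar>EV t x (?w \<omega>) (vhat m \<omega>) - Au \<omega>\<bar> \<partial>P)"
      by (rule nn_integral_add) measurable
    also have "\<dots> \<le> (M1 / ennreal M * e + 2 * ennreal L * M2 * e') + err"
    proof (rule add_mono)
      show "(\<integral>\<^sup>+\<omega>. ennreal \<bar>EV t x ?u (v' m) - EV t x (?w \<omega>) (vhat m \<omega>)\<bar> \<partial>P)
          \<le> M1 / ennreal M * e + 2 * ennreal L * M2 * e'"
      proof (rule EV_diff_le[OF fields])
        show "(\<integral>\<^sup>+\<omega>. ennreal \<bar>?u (next_grid t) z - ?w \<omega> (next_grid t) z\<bar> \<partial>P) \<le> e" for z
          using e[of z] r unfolding next_grid_eq[OF t] by (simp add: frozen_def E_def del: of_nat_Suc)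
        show "\<bar>?u (next_grid t) z\<bar> \<le> M" for z
          using at_grid(1)[OF i] M_pos unfolding next_grid_eq[OF t] by (simp add: frozen_def del: of_nat_Suc)
        show "\<bar>?w \<omega> (next_grid t) z\<bar> \<le> M" if "\<omega> \<in> space P" for z \<omega>
          using at_grid(2)[OF i that] M_pos unfolding next_grid_eq[OF t] by (simp add: frozen_def del: of_nat_Suc)
        show "(\<integral>\<^sup>+\<omega>. ennreal \<bar>v' m s z - vhat m \<omega> s z\<bar> \<partial>P) \<le> e'" if "t \<le> s" "s \<le> next_grid t" for s z
        proof -
          have "s \<in> {0..T}"
            using that t' r unfolding next_grid_eq[OF t] by auto
          then have "v' m s z = v m s z"
            by (simp add: v'_def)
          then show ?thesis
            using e'[of s z] that unfolding next_grid_eq[OF t] by (simp add: E_def)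
        qed
      qed
      have "(t, x) \<in> {0..<T} \<times> UNIV"
        using t' by simp
      then show "(\<integral>\<^sup>+\<omega>. ennreal \<bar>EV t x (?w \<omega>) (vhat m \<omega>) - Au \<omega>\<bar> \<partial>P) \<le> err"
        unfolding err_def operator_error_def Au_def
        by (rule SUP_upper2, unfold prod.case)
          (rule SUP_upper2[OF elements(1)], rule SUP_upper2[OF elements(2)], rule order_refl)
    qed
    finally show ?thesis
      by (simp add: add_ac)
  qed
  \<comment> \<open>The supremum is over all of the last \<open>n\<close> steps, so that \<open>D m n\<close> also covers the grid point at the end of a step, up to which the second argument is evaluated.\<close>
  define D where "D m n = (SUP (t, x)\<in>{real (N - n) * h..T} \<times> UNIV. E m t x)" for m n
  have D_upper: "E m t x \<le> D m n" if "real (N - n) * h \<le> t" "t \<le> T" for m n t x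
    unfolding D_def by (rule SUP_upper2[where i="(t, x)"]) (use that in auto)
  have "D m N \<le> err + D m N"
    by simp
  also have "\<dots> \<le> err * of_nat ((m + N) choose N) * c ^ (m + N)"
  proof (rule two_index_recursion_le[where A="M1 / ennreal M" and B="2 * ennreal L * M2"])
    have "E 0 t x = 0" for t x
      unfolding E_def by (subst nn_integral_cong[where v="\<lambda>_. 0"]) (auto simp: v0 vhat0)
    then show "D 0 n = 0" for n
      by (auto simp: D_def bot_ennreal intro!: antisym SUP_least)
    have "E m T x = 0" for m x
      unfolding E_def by (cases m; subst nn_integral_cong[where v="\<lambda>_. 0"]) (auto simp: v0 vhat0 vT vhatT)
    then show "D m 0 = 0" for m
      by (auto simp: D_def T bot_ennreal intro!: antisym SUP_least)
    fix m n assume n: "n < N"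
    define i where "i = N - Suc n"
    have i: "i < N" "N - n = Suc i"
      using n by (auto simp: i_def)
    show "D (Suc m) (Suc n) \<le> max (D (Suc m) n)
        (err + M1 / ennreal M * D (Suc m) n + 2 * ennreal L * M2 * D m (Suc n))"
    proof -
      have "E (Suc m) t x \<le> max (D (Suc m) n)
          (err + M1 / ennreal M * D (Suc m) n + 2 * ennreal L * M2 * D m (Suc n))"
        if t: "real i * h \<le> t" "t \<le> T" for t x
      proof (cases "t < ?r i")
        case True
        then have "E (Suc m) t x \<le> err + M1 / ennreal M * D (Suc m) n + 2 * ennreal L * M2 * D m (Suc n)"
          using t r_le[OF i(1)]
          by (intro local_error[OF i(1)] D_upper) (auto simp: i(2) i_def[symmetric] simp del: of_nat_Suc)
        then show ?thesis
          by (rule max.coboundedI2)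
      next
        case False
        with t show ?thesis
          by (intro max.coboundedI1 D_upper) (auto simp: i(2) simp del: of_nat_Suc)
      qed
      then show ?thesis
        unfolding D_def[of "Suc m" "Suc n"] i_def[symmetric] by (intro SUP_least) auto
    qed
  qed (auto simp: c_def le_max_iff_disj)
  finally show ?thesis
    by (simp add: D_def E_def)
qed

end

lemma generated_subset_sets:
  assumes "\<And>i. i \<in> I \<Longrightarrow> X i \<in> borel_measurable P"
  shows "sets (generated (space P) I X) \<subseteq> sets P" "space (generated (space P) I X) = space P"
proof -
  have gen: "{X i -` A \<inter> space P | i A. i \<in> I \<and> A \<in> sets borel} \<subseteq> sets P"
    using assms by (auto intro: measurable_sets)
  then show "sets (generated (space P) I X) \<subseteq> sets P"
    unfolding generated_def using sets.space_closed by (intro sets.sigma_sets_subset sets_measure_of[THEN equalityD1, THEN subset_trans]) blast+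
  show "space (generated (space P) I X) = space P"
    unfolding generated_def by (rule space_measure_of) auto
qed

text \<open>
  The laws of the increments from time 0 contain the measurability of \<open>W t\<close> with respect to the
  underlying measure itself.
\<close>

lemma brownian_motion_measurable:
  fixes W :: "real \<Rightarrow> 'w \<Rightarrow> real^'d::finite"
  assumes W: "brownian_motion P F W" and t: "0 \<le> t"
  shows "W t \<in> borel_measurable P"
proof (cases "t = 0")
  case True
  then show ?thesis
    using W by (subst measurable_cong[where g="\<lambda>_. 0"]) (auto simp: brownian_motion_def)
next
  case False
  with t have "0 < t"
    by simp
  then have "distributed P lborel (\<lambda>\<omega>. (W t \<omega> - W 0 \<omega>) $ i) (normal_density 0 (sqrt (t - 0)))" for i
    using W unfolding brownian_motion_def by (elim conjE allE[where x=0] allE[where x=t] impE) auto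
  from distributed_measurable[OF this]
  have "(\<lambda>\<omega>. (W t \<omega> - W 0 \<omega>) $ i) \<in> borel_measurable P" for i
    by simp
  moreover have "(\<lambda>\<omega>. (W t \<omega> - W 0 \<omega>) $ i) \<in> borel_measurable P \<longleftrightarrow> (\<lambda>\<omega>. W t \<omega> $ i) \<in> borel_measurable P" for i
    using W by (intro measurable_cong) (auto simp: brownian_motion_def)
  ultimately have "(\<lambda>\<omega>. W t \<omega> $ i) \<in> borel_measurable P" for i
    by simp
  then have "(\<lambda>\<omega>. \<Sum>b\<in>Basis. (W t \<omega> \<bullet> b) *\<^sub>R b) \<in> borel_measurable P"
    by (intro borel_measurable_sum borel_measurable_scaleR) (auto simp: Basis_vec_def inner_axis)
  then show ?thesis
    by (simp add: euclidean_representation)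
qed

theorem proposition2p8:
  fixes P :: "'w measure" and F :: "real \<Rightarrow> 'w measure"
    and W :: "real \<Rightarrow> 'w \<Rightarrow> real^'d::finite"
    and T h M C L\<phi> :: real and N l0 j0 m :: nat
    and XX :: "(real^'d) set" and X0 :: "real^'d"
    and \<mu> :: "real^'d \<Rightarrow> real^'d" and \<sigma> :: "real^'d \<Rightarrow> real^'d^'d"
    and X :: "real \<Rightarrow> 'w \<Rightarrow> real^'d"
    and g :: "real^'d \<Rightarrow> real" and f :: "real^'d \<Rightarrow> real \<Rightarrow> real"
    and Y Ybar :: "real \<Rightarrow> 'w \<Rightarrow> real" and Z Zbar :: "real \<Rightarrow> 'w \<Rightarrow> real^'d"
    and a :: "nat \<Rightarrow> nat \<Rightarrow> real^'d \<Rightarrow> real" and \<phi> :: "nat \<Rightarrow> real \<Rightarrow> real"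
    and fl :: "real^'d \<Rightarrow> real \<Rightarrow> real \<Rightarrow> real"
    and y :: "real \<Rightarrow> real^'d \<Rightarrow> real"
    and p :: "nat \<Rightarrow> real" and \<rho> :: "real \<Rightarrow> real"
    and Wk :: "nat list \<Rightarrow> real \<Rightarrow> 'w \<Rightarrow> real^'d"
    and \<xi> :: "nat list \<Rightarrow> 'w \<Rightarrow> nat" and \<delta> :: "nat list \<Rightarrow> 'w \<Rightarrow> real"
    and \<Phi> :: "real^'d \<Rightarrow> real \<Rightarrow> (real \<Rightarrow> real^'d) \<Rightarrow> real^'d"
    and U :: "nat \<Rightarrow> 'w \<Rightarrow> real"
    and nb :: nat and basis :: "nat \<Rightarrow> real \<Rightarrow> real^'d \<Rightarrow> real"
    and Ehat :: "(real \<Rightarrow> real^'d \<Rightarrow> real) \<Rightarrow> (real \<Rightarrow> real^'d \<Rightarrow> real) \<Rightarrow> 'w \<Rightarrow> real \<Rightarrow> real^'d \<Rightarrow> real"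
    and v :: "nat \<Rightarrow> real \<Rightarrow> real^'d \<Rightarrow> real"
    and vhat :: "nat \<Rightarrow> 'w \<Rightarrow> real \<Rightarrow> real^'d \<Rightarrow> real"
    and K :: "nat list set" and Fhat :: "'w measure"
    and L0 :: "(real \<Rightarrow> real^'d \<Rightarrow> real) set"
    and EV :: "real \<Rightarrow> real^'d \<Rightarrow> (real \<Rightarrow> real^'d \<Rightarrow> real) \<Rightarrow> (real \<Rightarrow> real^'d \<Rightarrow> real) \<Rightarrow> real"
    and M1 M2 err :: ennreal
  defines "fl \<equiv> \<lambda>x z z'. \<Sum>j=1..j0. \<Sum>l\<le>l0. a j l x * z ^ l * \<phi> j z'"
    and "K \<equiv> labels l0"
    and "EV \<equiv> \<lambda>t x u u'. \<integral>\<omega>. branch_op T h j0 a \<phi> p \<rho> \<Phi>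
                  (\<lambda>k s. Wk k s \<omega>) (\<lambda>k. \<xi> k \<omega>) (\<lambda>k. \<delta> k \<omega>) t x u u' \<partial>P"
    and "M1 \<equiv> SUP t\<in>{0..h}. \<integral>\<^sup>+\<omega>. of_nat (card (alive T (\<lambda>k. \<xi> k \<omega>) (\<lambda>k. \<delta> k \<omega>) t)) *
                  ennreal (majorant T C M p \<rho> (\<lambda>k. \<xi> k \<omega>) (\<lambda>k. \<delta> k \<omega>) t) \<partial>P"
    and "M2 \<equiv> SUP t\<in>{0..h}. \<integral>\<^sup>+\<omega>. of_nat (card (born T (\<lambda>k. \<xi> k \<omega>) (\<lambda>k. \<delta> k \<omega>) t)) *
                  ennreal (majorant T C M p \<rho> (\<lambda>k. \<xi> k \<omega>) (\<lambda>k. \<delta> k \<omega>) t) \<partial>P"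
    and "Fhat \<equiv> generated (space P) {1..} U"
    and "L0 \<equiv> Linf_span T (M_circ l0 C M) nb basis"
    and "err \<equiv> operator_error P Fhat T L0 EV Ehat"
  \<comment> \<open>forward process and BSDE\<close>
  assumes "T > 0" and "filtered_space P F" and "brownian_motion P F W"
    and "compact XX" and "X0 \<in> XX"
    and "\<exists>B. B-lipschitz_on UNIV \<mu>" and "closure {x. \<mu> x \<noteq> 0} \<subseteq> XX"
    and "\<exists>B. B-lipschitz_on UNIV \<sigma>" and "closure {x. \<sigma> x \<noteq> 0} \<subseteq> XX"
    and "sde_solution P F T W \<mu> \<sigma> X0 X"
    and "g \<in> borel_measurable borel" and "bounded (range g)"
    and "(\<lambda>(x, z). f x z) \<in> borel_measurable borel"
    and "\<exists>B. \<forall>x z. \<bar>f x z\<bar> \<le> B * (1 + norm x + \<bar>z\<bar>)"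
    and "\<exists>B. \<forall>x. B-lipschitz_on UNIV (f x)"
    and "bsde_solution P F T W (\<lambda>\<omega>. g (X T \<omega>)) (\<lambda>s \<omega> z. f (X s \<omega>) z) Y Z"
  \<comment> \<open>local polynomial driver\<close>
    and "l0 \<ge> 2" and "j0 \<ge> 1" and "C \<ge> 0"
    and "\<forall>j\<in>{1..j0}. \<forall>l\<le>l0. continuous_on UNIV (a j l) \<and> (\<forall>x. \<bar>a j l x\<bar> \<le> C)"
    and "\<forall>j\<in>{1..j0}. L\<phi>-lipschitz_on UNIV (\<phi> j) \<and> (\<forall>z. \<bar>\<phi> j z\<bar> \<le> 1)"
    and "\<forall>z. card {j\<in>{1..j0}. \<phi> j z \<noteq> 0} \<le> 2"
    and "\<forall>x. \<exists>B. B-lipschitz_on UNIV (\<lambda>z. fl x z z)"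
    and "unique_bsde_solution P F T W (\<lambda>\<omega>. g (X T \<omega>)) (\<lambda>s \<omega> z. fl (X s \<omega>) z z) Ybar Zbar"
    and "M \<ge> 1" and "AE \<omega> in P. \<bar>g (X T \<omega>)\<bar> \<le> M"
    and "AE \<omega> in P. \<forall>t\<in>{0..T}. norm (X t \<omega>) + \<bar>Y t \<omega>\<bar> \<le> M \<and> \<bar>Ybar t \<omega>\<bar> \<le> M"
    and "\<forall>t\<in>{0..T}. \<forall>x. \<bar>y t x\<bar> \<le> M" and "y T = g"
    and "0 < h" and "h < h_circ l0 C M" and "real N * h = T"
  \<comment> \<open>branching particles\<close>
    and "\<forall>l\<le>l0. p l \<ge> 0" and "(\<Sum>l\<le>l0. p l) = 1"
    and "continuous_on {0..} \<rho>" and "\<forall>t\<ge>0. \<rho> t > 0" and "tail_integral \<rho> 0 = 1"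
    and "\<forall>k\<in>K. brownian_motion P (\<lambda>t. generated (space P) {0..t} (Wk k)) (Wk k)"
    and "prob_space.indep_sets P (\<lambda>k. sets (generated (space P) {0..} (Wk k))) K"
    and "prob_space.indep_vars P (\<lambda>_. count_space UNIV) \<xi> K"
    and "\<forall>k\<in>K. \<forall>\<omega>\<in>space P. \<xi> k \<omega> \<le> l0 \<and> \<delta> k \<omega> \<ge> 0"
    and "\<forall>k\<in>K. \<forall>l\<le>l0. measure P {\<omega>\<in>space P. \<xi> k \<omega> = l} = p l"
    and "prob_space.indep_vars P (\<lambda>_. borel) \<delta> K"
    and "\<forall>k\<in>K. \<forall>t\<ge>0. measure P {\<omega>\<in>space P. \<delta> k \<omega> > t} = tail_integral \<rho> t"
    and "(\<lambda>(x, s, w). \<Phi> x s w) \<in> borel_measurable (borel \<Otimes>\<^sub>M predictable T)"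
    and "\<forall>x. sde_solution P F T W \<mu> \<sigma> x (\<lambda>s \<omega>. \<Phi> x s (\<lambda>r. W r \<omega>))"
  \<comment> \<open>approximate operator\<close>
    and "prob_space.indep_vars P (\<lambda>_. borel) U {1..}"
    and "\<forall>i\<ge>1. distr P borel (U i) = uniform_measure lborel {0..1}"
    and "prob_space.indep_sets P (\<lambda>c. sets (
           [generated (space P) {0..} W,
            generated (space P) (K \<times> {0..}) (\<lambda>(k, t). Wk k t),
            generated (space P) K \<xi>,
            generated (space P) K \<delta>,
            Fhat] ! c)) {..<5}"
    and "\<forall>u\<in>L0. \<forall>u'\<in>L0. \<forall>\<omega>\<in>space P. Ehat u u' \<omega> \<in> L0"
    and "\<forall>u\<in>random_elements P Fhat L0. \<forall>u'\<in>random_elements P Fhat L0.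
           (\<lambda>((t, x), \<omega>). Ehat (u \<omega>) (u' \<omega>) \<omega> t x) \<in> borel_measurable (borel \<Otimes>\<^sub>M Fhat)"
    and "err < \<infinity>"
  \<comment> \<open>iterates\<close>
    and "exact_iterates T h N M g y EV v"
    and "numerical_iterates P T h N M (M_circ l0 C M) L0 g y Ehat vhat"
    and "m \<ge> 1"
  shows "(SUP (t, x)\<in>{0..T} \<times> UNIV. \<integral>\<^sup>+\<omega>. ennreal \<bar>v m t x - vhat m \<omega> t x\<bar> \<partial>P)
         \<le> err * ennreal ((1 + real N) * ((real m + real N) ^ N / fact N)) *
           (max (max (2 * ennreal L\<phi> * M2) (M1 / ennreal M)) 1) ^ (m + N)"
proof -
  interpret P: prob_space P
    using assms(10) unfolding filtered_space_def by auto
  have L: "0 \<le> L\<phi>"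
    using assms(26,29) lipschitz_on_nonneg by (metis atLeastAtMost_iff order_refl)
  have "1 \<le> N"
    using assms(9,40) by (cases N) auto
  then have h_le: "h \<le> T"
    using mult_right_mono[of 1 "real N" h] assms(38,40) by simp
  interpret B: branching_diffusion P T h M C L\<phi> l0 j0 a \<phi> p \<rho> \<Phi> Wk \<xi> \<delta>
  proof unfold_locales
    show "(\<lambda>(x, s, w). \<Phi> x s w) \<in> borel_measurable (borel \<Otimes>\<^sub>M predictable T)"
      by (rule assms(53))
    fix k assume k: "k \<in> labels l0"
    then have W: "brownian_motion P (\<lambda>t. generated (space P) {0..t} (Wk k)) (Wk k)"
      using assms(46) by (simp add: assms(2))
    show "Wk k t \<in> borel_measurable P" if "0 \<le> t" for t
      by (rule brownian_motion_measurable[OF W that])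
    show "continuous_on {0..} (\<lambda>t. Wk k t \<omega>)" if "\<omega> \<in> space P" for \<omega>
      using W that by (simp add: brownian_motion_def)
    show "\<xi> k \<in> measurable P (count_space UNIV)" "\<delta> k \<in> borel_measurable P"
      using assms(48,51) k unfolding P.indep_vars_def by (auto simp: assms(2))
    show "\<xi> k \<omega> \<le> l0" "0 \<le> \<delta> k \<omega>" if "\<omega> \<in> space P" for \<omega>
      using assms(49) k that by (auto simp: assms(2))
    show "measure P {\<omega> \<in> space P. t < \<delta> k \<omega>} = tail_integral \<rho> t" if "0 \<le> t" for t
      using assms(52) k that by (auto simp: assms(2))
  qed (use assms(27-30,33,38,41,43,44) L h_le in \<open>auto intro: less_imp_le\<close>)
  have EV: "EV = B.EV" and M1: "M1 = B.M1" and M2: "M2 = B.M2"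
    by (simp_all add: assms(3-5) B.EV_def B.M1_def B.M2_def fun_eq_iff)
  have U: "U i \<in> borel_measurable P" if "i \<in> {1..}" for i
    using assms(55) that unfolding P.indep_vars_def by auto
  have Fhat: "sets Fhat \<subseteq> sets P" "space Fhat = space P"
    using generated_subset_sets[of "{1..}" U P, OF U] unfolding assms(6) by blast+
  have g_bound: "\<bar>g x\<bar> \<le> M" for x
    using assms(9,36,37) by auto
  have "(SUP (t, x)\<in>{0..T} \<times> UNIV. \<integral>\<^sup>+\<omega>. ennreal \<bar>v m t x - vhat m \<omega> t x\<bar> \<partial>P)
      \<le> err * of_nat ((m + N) choose N) * (max (max (2 * ennreal L\<phi> * M2) (M1 / ennreal M)) 1) ^ (m + N)"
    unfolding assms(8) EV M1 M2
  proof (rule B.scheme_error_le[OF assms(40) Fhat])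
    show "L0 \<subseteq> Linf T (M_circ l0 C M)"
      unfolding assms(7) Linf_span_def by auto
    show "Ehat u u' \<omega> \<in> L0" if "u \<in> L0" "u' \<in> L0" "\<omega> \<in> space P" for u u' \<omega>
      using assms(58) that by auto
    show "random_field Fhat (\<lambda>\<omega>. Ehat (u \<omega>) (u' \<omega>) \<omega>)"
      if "u \<in> random_elements P Fhat L0" "u' \<in> random_elements P Fhat L0" for u u'
      using assms(59) that by (auto simp: random_field_def)
    show "exact_iterates T h N M g y B.EV v"
      using assms(61) by (simp add: EV)
  qed (fact assms(19) g_bound assms(62))+
  also have "\<dots> \<le> err * ennreal ((1 + real N) * ((real m + real N) ^ N / fact N)) *
      (max (max (2 * ennreal L\<phi> * M2) (M1 / ennreal M)) 1) ^ (m + N)"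
    using binomial_le_scheme_constant[of m N]
    by (intro mult_right_mono mult_left_mono) (auto simp: ennreal_of_nat_eq_real_of_nat)
  finally show ?thesis .
qed

end
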